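(* Let $n,m\ge1$ be integers with $nm>1$ and let $\psi:\mathbb{N}\to\mathbb{R}^+$ satisfy $\psi(h)<1/2$ for all $h\in\mathbb{N}$ and $\sum_{h=1}^\infty h^{n-1}\psi(h)^m=\infty$. Then $\sum_{\mathbf{q}\in\mathbb{Z}^n\setminus\{\mathbf{0}\}}|B'_{\mathbf{q}}(\psi)|=\infty$, and there exists a constant $C>1$ such that for all sufficiently large $N$, $$\sum_{\substack{\mathbf{q}_1,\mathbf{q}_2\in\mathbb{Z}^n\setminus\{\mathbf{0}\}\\ |\mathbf{q}_1|\le N,\ |\mathbf{q}_2|\le N}}|B'_{\mathbf{q}_1}(\psi)\cap B'_{\mathbf{q}_2}(\psi)|\le C\Big(\sum_{\mathbf{q}_1\in\mathbb{Z}^n\setminus\{\mathbf{0}\},\ |\mathbf{q}_1|\le N}|B'_{\mathbf{q}_1}(\psi)|\Big)^2.$$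
   Context: $\mathbb{I}^{nm}=[0,1]^{nm}$; $|\cdot|$ of a set is $nm$-dimensional Lebesgue measure, of a vector the supremum norm. $\mathbf{X}\in\mathbb{I}^{nm}$ is an $n\times m$ matrix, $\mathbf{q}\in\mathbb{Z}^n$ a row vector, $\mathbf{q}\mathbf{X}\in\mathbb{R}^m$. $\gcd(\mathbf{p},\mathbf{q})$ is the gcd of all coordinates of $\mathbf{p}\in\mathbb{Z}^m$ and $\mathbf{q}\in\mathbb{Z}^n$. For $\delta>0$ and $\mathbf{q}\in\mathbb{Z}^n\setminus\{\mathbf{0}\}$, $B'(\mathbf{q},\delta)=\{\mathbf{X}\in\mathbb{I}^{nm}: |\mathbf{q}\mathbf{X}+\mathbf{p}|<\delta \text{ for some } \mathbf{p}\in\mathbb{Z}^m \text{ with } \gcd(\mathbf{p},\mathbf{q})=1\}$, and $B'_{\mathbf{q}}(\psi):=B'(\mathbf{q},\psi(|\mathbf{q}|))$. *)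

theory Defs
  imports "HOL-Analysis.Analysis"
begin

definition unit_cube :: "(real ^ 'm ^ 'n) set" where
  "unit_cube = {X. \<forall>i j. 0 \<le> X $ i $ j \<and> X $ i $ j \<le> 1}"

definition real_vec :: "int ^ 'k \<Rightarrow> real ^ 'k" where
  "real_vec q = (\<chi> i. real_of_int (q $ i))"

text \<open>
  The supremum norm of an integer vector, as a natural number so that it can be an argument
  of \<open>\<psi>\<close>. On real vectors the supremum norm is \<^const>\<open>infnorm\<close>.
\<close>

definition int_supnorm :: "int ^ 'k \<Rightarrow> nat" where
  "int_supnorm q = Max (range (\<lambda>i. nat \<bar>q $ i\<bar>))"

definition joint_gcd :: "int ^ 'm \<Rightarrow> int ^ 'n \<Rightarrow> int" where
  "joint_gcd p q = Gcd (range (\<lambda>j. p $ j) \<union> range (\<lambda>i. q $ i))"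

definition B' :: "int ^ 'n \<Rightarrow> real \<Rightarrow> (real ^ 'm ^ 'n) set" where
  "B' q \<delta> = {X \<in> unit_cube.
     \<exists>p :: int ^ 'm. joint_gcd p q = 1 \<and> infnorm (real_vec q v* X + real_vec p) < \<delta>}"

definition B'_at :: "(nat \<Rightarrow> real) \<Rightarrow> int ^ 'n \<Rightarrow> (real ^ 'm ^ 'n) set" where
  "B'_at \<psi> q = B' q (\<psi> (int_supnorm q))"

definition nonzero_ball :: "nat \<Rightarrow> (int ^ 'n) set" where
  "nonzero_ball N = {q. q \<noteq> 0 \<and> int_supnorm q \<le> N}"

text \<open>
  The next facts show that the two conventions for totality, \<^const>\<open>sum\<close> over infinite sets and
  \<^const>\<open>measure\<close> of non-measurable sets, do not affect sums of measures over
  \<^const>\<open>nonzero_ball\<close>.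
\<close>

lemma int_supnorm_eq_infnorm: "real (int_supnorm q) = infnorm (real_vec q)"
proof -
  have "infnorm (real_vec q) = Max (range (\<lambda>i. real (nat \<bar>q $ i\<bar>)))"
    by (simp add: infnorm_cart real_vec_def cSup_eq_Max full_SetCompr_eq)
  also have "\<dots> = real (int_supnorm q)"
    unfolding int_supnorm_def
    by (subst mono_Max_commute[of real]) (auto simp: mono_def image_image)
  finally show ?thesis by simp
qed

lemma finite_nonzero_ball: "finite (nonzero_ball N :: (int ^ 'n) set)"
proof -
  have "vec_nth ` (nonzero_ball N :: (int ^ 'n) set) \<subseteq> PiE UNIV (\<lambda>_. {- int N..int N})"
  proof
    fix f assume "f \<in> vec_nth ` (nonzero_ball N :: (int ^ 'n) set)"
    then obtain q :: "int ^ 'n" where f: "f = vec_nth q" and q: "int_supnorm q \<le> N"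
      by (auto simp: nonzero_ball_def)
    have "nat \<bar>q $ i\<bar> \<le> N" for i
      using q Max_ge[of "range (\<lambda>i. nat \<bar>q $ i\<bar>)" "nat \<bar>q $ i\<bar>"]
      by (simp add: int_supnorm_def)
    then have "\<bar>q $ i\<bar> \<le> int N" for i
      by (simp add: nat_le_iff)
    then have "- int N \<le> q $ i \<and> q $ i \<le> int N" for i
      by (simp add: abs_le_iff minus_le_iff)
    then show "f \<in> PiE UNIV (\<lambda>_. {- int N..int N})"
      by (simp add: f PiE_def)
  qed
  moreover have "finite (PiE (UNIV :: 'n set) (\<lambda>_. {- int N..int N}))"
    by (intro finite_PiE) auto
  ultimately have "finite (vec_nth ` (nonzero_ball N :: (int ^ 'n) set))"
    by (rule finite_subset)
  then show ?thesis
    by (rule finite_imageD) (auto simp: inj_on_def vec_nth_inject)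
qed

lemma B'_lmeasurable: "(B' q \<delta> :: (real ^ 'm ^ 'n) set) \<in> lmeasurable"
proof -
  have cube: "(unit_cube :: (real ^ 'm ^ 'n) set) = cbox 0 (\<chi> i j. 1)"
    by (rule set_eqI)
      (force simp: unit_cube_def mem_box Basis_vec_def inner_axis)
  let ?U = "{X :: real ^ 'm ^ 'n. \<exists>p :: int ^ 'm. joint_gcd p q = 1 \<and>
      infnorm (real_vec q v* X + real_vec p) < \<delta>}"
  have "open {X :: real ^ 'm ^ 'n. infnorm (real_vec q v* X + real_vec p) < \<delta>}" for p :: "int ^ 'm"
    unfolding vector_matrix_mult_def
    by (intro open_Collect_less continuous_intros)
  then have "open (\<Union>p\<in>{p :: int ^ 'm. joint_gcd p q = 1}.
      {X :: real ^ 'm ^ 'n. infnorm (real_vec q v* X + real_vec p) < \<delta>})"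
    by (intro open_UN) auto
  also have "(\<Union>p\<in>{p :: int ^ 'm. joint_gcd p q = 1}.
      {X :: real ^ 'm ^ 'n. infnorm (real_vec q v* X + real_vec p) < \<delta>}) = ?U"
    by auto
  finally have "?U \<in> sets lebesgue" by (simp add: borel_open)
  moreover have "B' q \<delta> = (cbox 0 (\<chi> i j. 1)) \<inter> ?U"
    by (auto simp: B'_def cube)
  ultimately show ?thesis
    by (simp add: fmeasurable_Int_fmeasurable)
qed

end

theory Submission
  imports Defs
begin

text \<open>
  Both estimates come from averaging. The sets \<open>B' q \<delta>\<close> are restrictions to the cube of
  \<open>\<int>\<close>-periodic sets, so their measure can be computed by integrating over translates
  \<open>X + u s\<close>, for any vector \<open>u\<close> and \<open>s\<close> in a cube of \<open>\<real>\<^sup>m\<close>; on such a fibre \<open>q X\<close> becomes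
  \<open>q X + (q \<bullet> u) s\<close>. If \<open>q\<^sub>1, q\<^sub>2\<close> are linearly independent, two such directions make
  \<open>q\<^sub>1 X\<close> and \<open>q\<^sub>2 X\<close> vary independently. If they are parallel but \<open>q\<^sub>1 \<noteq> \<plusminus> q\<^sub>2\<close>, coprimality
  forces \<open>p\<^sub>j b \<noteq> p'\<^sub>j a\<close> for some \<open>j\<close> (with \<open>a, b\<close> matching entries of \<open>q\<^sub>1, q\<^sub>2\<close>), hence
  \<open>gcd a b < \<bar>b\<bar> \<delta>\<^sub>1 + \<bar>a\<bar> \<delta>\<^sub>2\<close>, and under this inequality a lattice point count gives
  an overlap \<open>\<lesssim> \<delta>\<^sub>1 \<delta>\<^sub>2\<close> in every coordinate. So all pairs apart from \<open>q\<^sub>1 = \<plusminus> q\<^sub>2\<close> satisfy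
  \<open>\<bar>B'\<^sub>1 \<inter> B'\<^sub>2\<bar> \<lesssim> (\<delta>\<^sub>1 \<delta>\<^sub>2)\<^sup>m\<close>. It remains to see that \<open>\<bar>B' q \<delta>\<bar>\<close> is \<open>\<greatersim> \<delta>\<^sup>m\<close> on average over
  \<open>\<bar>q\<bar> = h\<close>: for \<open>q\<close> with an entry \<open>h\<close> and the others in \<open>{1..h}\<close> the measure is
  \<open>(2\<delta>/h)\<^sup>m\<close> times the number of \<open>p \<in> {1..h}\<^sup>m\<close> coprime to \<open>q\<close>, and since
  \<open>n - 1 + m \<ge> 2\<close> at most \<open>\<Sum>\<^sub>l\<^sub>\<ge>\<^sub>2 l\<^sup>-\<^sup>2 \<le> 3/4\<close> of all pairs \<open>(q, p)\<close> have a common factor.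
\<close>

section \<open>Periodic sets and averaging over translates\<close>

definition lattice :: "'a::euclidean_space set" where
  "lattice = {k. \<forall>b\<in>Basis. k \<bullet> b \<in> \<int>}"

text \<open>Half-open, so that its lattice translates partition the space exactly; translates of the
  closed cube would overlap on faces.\<close>

definition unit_cell :: "'a::euclidean_space set" where
  "unit_cell = {x. \<forall>b\<in>Basis. 0 \<le> x \<bullet> b \<and> x \<bullet> b < 1}"

lemma lattice_minus: "- k \<in> lattice" if "k \<in> lattice"
  using that by (simp add: lattice_def)

lemma countable_lattice: "countable (lattice :: 'a::euclidean_space set)"
proof -
  have "lattice \<subseteq> (\<lambda>f. \<Sum>b\<in>Basis. real_of_int (f b) *\<^sub>R b) ` PiE (Basis :: 'a set) (\<lambda>_. UNIV)"
  proof
    fix k :: 'a assume k: "k \<in> lattice"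
    have "k = (\<Sum>b\<in>Basis. real_of_int (restrict (\<lambda>b. \<lfloor>k \<bullet> b\<rfloor>) Basis b) *\<^sub>R b)"
      by (subst euclidean_representation[symmetric, of k], intro sum.cong)
        (use k in \<open>auto simp: lattice_def elim!: Ints_cases\<close>)
    then show "k \<in> (\<lambda>f. \<Sum>b\<in>Basis. real_of_int (f b) *\<^sub>R b) ` PiE (Basis :: 'a set) (\<lambda>_. UNIV)"
      by (rule image_eqI[where x="restrict (\<lambda>b. \<lfloor>k \<bullet> b\<rfloor>) Basis"]) auto
  qed
  then show ?thesis
    by (rule countable_subset) (intro countable_image countable_PiE, auto)
qed

lemma unit_cell_translates_cover: "\<exists>k\<in>lattice. x - k \<in> unit_cell"
proof
  show "(\<Sum>b\<in>Basis. real_of_int \<lfloor>x \<bullet> b\<rfloor> *\<^sub>R b) \<in> lattice"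
    by (auto simp: lattice_def inner_sum_left_Basis)
  show "x - (\<Sum>b\<in>Basis. real_of_int \<lfloor>x \<bullet> b\<rfloor> *\<^sub>R b) \<in> unit_cell"
    by (auto simp: unit_cell_def inner_diff_left inner_sum_left_Basis) linarith
qed

lemma unit_cell_translates_disjoint:
  assumes "k \<in> lattice" "l \<in> lattice" "x - k \<in> unit_cell" "x - l \<in> unit_cell"
  shows "k = l"
proof (rule euclidean_eqI)
  fix b :: 'a assume b: "b \<in> Basis"
  obtain i j where i: "k \<bullet> b = of_int i" and j: "l \<bullet> b = of_int j"
    using assms(1,2) b unfolding lattice_def by (metis (no_types, lifting) Ints_cases mem_Collect_eq)
  have "\<bar>real_of_int i - of_int j\<bar> < 1"
    using assms(3,4) b i j by (fastforce simp: unit_cell_def inner_diff_left)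
  then have "i = j" by linarith
  then show "k \<bullet> b = l \<bullet> b" using i j by simp
qed

lemma unit_cell_borel [measurable]: "unit_cell \<in> sets borel"
proof -
  have "unit_cell = (\<Inter>b\<in>Basis. {x::'a. 0 \<le> x \<bullet> b} \<inter> {x. x \<bullet> b < 1})"
    by (auto simp: unit_cell_def)
  also have "\<dots> \<in> sets borel"
    by (intro sets.finite_INT sets.Int borel_closed borel_open)
      (auto intro!: closed_Collect_le open_Collect_less continuous_intros)
  finally show ?thesis .
qed

text \<open>The cell lies between the open and the closed cube, whose difference is a null set. This
  passes from the tiling cell to the cube of the statement.\<close>

lemma emeasure_Int_unit_cell:
  fixes S :: "'a::euclidean_space set"
  assumes [measurable]: "S \<in> sets borel"
  shows "emeasure lborel (S \<inter> unit_cell) = emeasure lborel (S \<inter> cbox 0 One)"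
proof (rule emeasure_eq_AE)
  have "AE x in lborel. x \<notin> cbox 0 One - box 0 (One::'a)"
  proof (rule AE_not_in)
    have "emeasure lborel (cbox 0 One - box 0 (One::'a)) = 0"
      by (subst emeasure_Diff) (auto simp: box_subset_cbox emeasure_lborel_box_eq)
    then show "cbox 0 One - box 0 (One::'a) \<in> null_sets lborel" by auto
  qed
  then show "AE x in lborel. x \<in> S \<inter> unit_cell \<longleftrightarrow> x \<in> S \<inter> cbox 0 One"
    by eventually_elim (auto simp: unit_cell_def mem_box less_imp_le)
qed auto

lemma emeasure_lborel_translate:
  fixes A :: "'a::euclidean_space set"
  assumes [measurable]: "A \<in> sets borel"
  shows "emeasure lborel {x. x + v \<in> A} = emeasure lborel A"
proof -
  have "emeasure lborel A = emeasure (distr lborel borel ((+) v)) A"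
    by (simp add: lborel_distr_plus)
  also have "\<dots> = emeasure lborel {x. x + v \<in> A}"
    by (subst emeasure_distr) (auto simp: vimage_def add.commute)
  finally show ?thesis by simp
qed

section \<open>Averaging periodic sets over translates\<close>

definition periodic_set :: "'a::euclidean_space set \<Rightarrow> bool" where
  "periodic_set S \<longleftrightarrow> (\<forall>k\<in>lattice. \<forall>x\<in>S. x + k \<in> S)"

lemma periodic_set_iff: "x + k \<in> S \<longleftrightarrow> x \<in> S" if "periodic_set S" "k \<in> lattice"
  using that lattice_minus[of k] unfolding periodic_set_def
  by (metis add_diff_cancel_right' diff_conv_add_uminus)

text \<open>Cut the shifted cell along the lattice translates of \<open>unit_cell\<close> and move
  each piece back by its lattice vector. Periodicity preserves \<open>S\<close>, and the pieces
  reassemble \<open>unit_cell\<close>.\<close>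

lemma emeasure_periodic_translate:
  fixes S :: "'a::euclidean_space set"
  assumes [measurable]: "S \<in> sets borel" and per: "periodic_set S"
  shows "emeasure lborel {x \<in> unit_cell. x + v \<in> S} = emeasure lborel (S \<inter> unit_cell)"
proof -
  have [measurable]: "{x. x + w \<in> unit_cell} \<in> sets borel" for w :: 'a by measurable
  have [measurable]: "{x. x + w \<in> S} \<in> sets borel" for w :: 'a by measurable
  have "emeasure lborel {x \<in> unit_cell. x + v \<in> S}
      = emeasure lborel {x. x + v \<in> S \<inter> {y. y - v \<in> unit_cell}}"
    by (rule arg_cong[where f="emeasure lborel"]) auto
  also have "\<dots> = emeasure lborel (S \<inter> {y. y - v \<in> unit_cell})"
    by (rule emeasure_lborel_translate) measurable
  also have "S \<inter> {y. y - v \<in> unit_cell}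
      = (\<Union>k\<in>lattice. S \<inter> {y. y - v \<in> unit_cell} \<inter> {y. y - k \<in> unit_cell})"
    using unit_cell_translates_cover by auto
  also have "emeasure lborel \<dots> = (\<integral>\<^sup>+k. emeasure lborel
      (S \<inter> {y. y - v \<in> unit_cell} \<inter> {y. y - k \<in> unit_cell}) \<partial>count_space lattice)"
    by (rule emeasure_UN_countable)
      (auto simp: countable_lattice disjoint_family_on_def dest: unit_cell_translates_disjoint)
  also have "\<dots> = (\<integral>\<^sup>+k. emeasure lborel
      (S \<inter> unit_cell \<inter> {y. y - v + k \<in> unit_cell}) \<partial>count_space lattice)"
  proof (rule nn_integral_cong)
    fix k :: 'a assume "k \<in> space (count_space lattice)"
    then have k: "k \<in> lattice" by simp
    have "emeasure lborel (S \<inter> {y. y - v \<in> unit_cell} \<inter> {y. y - k \<in> unit_cell})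
      = emeasure lborel {x. x + k \<in> S \<inter> {y. y - v \<in> unit_cell} \<inter> {y. y - k \<in> unit_cell}}"
      by (rule emeasure_lborel_translate[symmetric]) measurable
    also have "{x. x + k \<in> S \<inter> {y. y - v \<in> unit_cell} \<inter> {y. y - k \<in> unit_cell}}
        = S \<inter> unit_cell \<inter> {y. y - v + k \<in> unit_cell}"
      using periodic_set_iff[OF per k] by (auto simp: algebra_simps)
    finally show "emeasure lborel (S \<inter> {y. y - v \<in> unit_cell} \<inter> {y. y - k \<in> unit_cell})
      = emeasure lborel (S \<inter> unit_cell \<inter> {y. y - v + k \<in> unit_cell})" .
  qed
  also have "\<dots> = emeasure lborel (\<Union>k\<in>lattice. S \<inter> unit_cell \<inter> {y. y - v + k \<in> unit_cell})"
  proof (rule emeasure_UN_countable[symmetric])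
    show "disjoint_family_on (\<lambda>k. S \<inter> unit_cell \<inter> {y. y - v + k \<in> unit_cell}) lattice"
      unfolding disjoint_family_on_def
    proof safe
      fix k l x assume "k \<in> lattice" "l \<in> lattice" "k \<noteq> l"
        and "x - v + k \<in> unit_cell" "x - v + l \<in> unit_cell"
      then show "x \<in> {}"
        using unit_cell_translates_disjoint[of "- k" "- l" "x - v"] by (simp add: lattice_minus)
    qed
  qed (auto simp: countable_lattice)
  also have "(\<Union>k\<in>lattice. S \<inter> unit_cell \<inter> {y. y - v + k \<in> unit_cell}) = S \<inter> unit_cell"
  proof -
    have "\<exists>k\<in>lattice. y - v + k \<in> unit_cell" for y
      using unit_cell_translates_cover[of "y - v"] lattice_minus
      by (metis diff_conv_add_uminus)
    then show ?thesis by auto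
  qed
  finally show ?thesis .
qed

text \<open>Fubini on pairs \<open>(x, s)\<close>: for fixed \<open>s\<close> the shift by
  \<open>L s\<close> does not change the measure of \<open>S\<close> in a cell, so integrating over
  \<open>s\<close> only contributes the measure of \<open>P\<close>. Uniform bounds on fibres
  thereby become bounds for \<open>S\<close>.\<close>

lemma emeasure_periodic_average:
  fixes S :: "'a::euclidean_space set" and L :: "'b::euclidean_space \<Rightarrow> 'a"
  assumes [measurable]: "S \<in> sets borel" "P \<in> sets borel" "L \<in> borel_measurable borel"
    and per: "periodic_set S"
  shows "emeasure lborel P * emeasure lborel (S \<inter> unit_cell)
    = (\<integral>\<^sup>+x. emeasure lborel {s \<in> P. x + L s \<in> S} * indicator unit_cell x \<partial>lborel)"
proof -
  have [measurable]: "{s \<in> P. x + L s \<in> S} \<in> sets borel" for x by measurable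
  have [measurable]: "{x \<in> unit_cell. x + L s \<in> S} \<in> sets borel" for s by measurable
  have "(\<integral>\<^sup>+x. emeasure lborel {s \<in> P. x + L s \<in> S} * indicator unit_cell x \<partial>lborel)
    = (\<integral>\<^sup>+x. (\<integral>\<^sup>+s. indicator S (x + L s) * indicator P s * indicator unit_cell x \<partial>lborel) \<partial>lborel)"
  proof (rule nn_integral_cong)
    fix x
    have "emeasure lborel {s \<in> P. x + L s \<in> S} = (\<integral>\<^sup>+s. indicator S (x + L s) * indicator P s \<partial>lborel)"
      by (subst nn_integral_indicator[symmetric], simp, rule nn_integral_cong)
        (auto simp: indicator_def)
    then show "emeasure lborel {s \<in> P. x + L s \<in> S} * indicator unit_cell x
      = (\<integral>\<^sup>+s. indicator S (x + L s) * indicator P s * indicator unit_cell x \<partial>lborel)"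
      by (simp add: nn_integral_multc)
  qed
  also have "\<dots> = (\<integral>\<^sup>+s. (\<integral>\<^sup>+x. indicator S (x + L s) * indicator P s * indicator unit_cell x \<partial>lborel) \<partial>lborel)"
    by (rule lborel_pair.Fubini') measurable
  also have "\<dots> = (\<integral>\<^sup>+s. emeasure lborel (S \<inter> unit_cell) * indicator P s \<partial>lborel)"
  proof (rule nn_integral_cong)
    fix s
    have "(\<integral>\<^sup>+x. indicator S (x + L s) * indicator P s * indicator unit_cell x \<partial>lborel)
      = (\<integral>\<^sup>+x. indicator {x \<in> unit_cell. x + L s \<in> S} x * indicator P s \<partial>lborel)"
      by (rule nn_integral_cong) (auto simp: indicator_def)
    also have "\<dots> = emeasure lborel {x \<in> unit_cell. x + L s \<in> S} * indicator P s"
      by (simp add: nn_integral_multc)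
    finally show "(\<integral>\<^sup>+x. indicator S (x + L s) * indicator P s * indicator unit_cell x \<partial>lborel)
      = emeasure lborel (S \<inter> unit_cell) * indicator P s"
      by (simp add: emeasure_periodic_translate per)
  qed
  also have "\<dots> = emeasure lborel P * emeasure lborel (S \<inter> unit_cell)"
    by (simp add: nn_integral_cmult mult.commute[of _ "emeasure lborel (S \<inter> unit_cell)"])
  finally show ?thesis by simp
qed

lemma emeasure_unit_cell: "emeasure lborel (unit_cell :: 'a::euclidean_space set) = 1"
  using emeasure_Int_unit_cell[of "UNIV :: 'a set"] by (simp add: emeasure_lborel_cbox_eq)

lemma emeasure_periodic_le:
  fixes S :: "'a::euclidean_space set" and L :: "'b::euclidean_space \<Rightarrow> 'a"
  assumes S: "S \<in> sets borel" "P \<in> sets borel" "L \<in> borel_measurable borel" "periodic_set S"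
    and P: "emeasure lborel P = 1"
    and K: "\<And>x. emeasure lborel {s \<in> P. x + L s \<in> S} \<le> K"
  shows "emeasure lborel (S \<inter> cbox 0 One) \<le> K"
proof -
  have "emeasure lborel (S \<inter> unit_cell) \<le> (\<integral>\<^sup>+x. K * indicator unit_cell x \<partial>(lborel :: 'a measure))"
    using emeasure_periodic_average[OF S] P
    by (simp, intro nn_integral_mono mult_right_mono K) auto
  also have "\<dots> = K"
    by (simp add: nn_integral_cmult emeasure_unit_cell)
  finally show ?thesis
    by (simp add: emeasure_Int_unit_cell S)
qed

lemma emeasure_periodic_ge:
  fixes S :: "'a::euclidean_space set" and L :: "'b::euclidean_space \<Rightarrow> 'a"
  assumes S: "S \<in> sets borel" "P \<in> sets borel" "L \<in> borel_measurable borel" "periodic_set S"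
    and K: "\<And>x. K \<le> emeasure lborel {s \<in> P. x + L s \<in> S}"
  shows "K \<le> emeasure lborel P * emeasure lborel (S \<inter> cbox 0 One)"
proof -
  have "K = (\<integral>\<^sup>+x. K * indicator unit_cell x \<partial>(lborel :: 'a measure))"
    by (simp add: nn_integral_cmult emeasure_unit_cell)
  also have "\<dots> \<le> emeasure lborel P * emeasure lborel (S \<inter> unit_cell)"
    unfolding emeasure_periodic_average[OF S]
    by (intro nn_integral_mono mult_right_mono K) auto
  finally show ?thesis
    by (simp add: emeasure_Int_unit_cell S)
qed

section \<open>Measures of coordinatewise products\<close>

lemma vec_prod_borel:
  fixes A :: "'m::finite \<Rightarrow> real set"
  assumes [measurable]: "\<And>j. A j \<in> sets borel"
  shows "{s :: real ^ 'm. \<forall>j. s $ j \<in> A j} \<in> sets borel"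
proof -
  have "{s :: real ^ 'm. \<forall>j. s $ j \<in> A j} = (\<Inter>j. (\<lambda>s. s $ j) -` A j \<inter> space borel)" by auto
  also have "\<dots> \<in> sets borel"
    by (intro sets.finite_INT measurable_sets[where A=borel]) auto
  finally show ?thesis .
qed

lemma emeasure_lborel_vec_prod:
  fixes A :: "'m::finite \<Rightarrow> real set"
  assumes [measurable]: "\<And>j. A j \<in> sets borel"
  shows "emeasure lborel {s :: real ^ 'm. \<forall>j. s $ j \<in> A j} = (\<Prod>j\<in>UNIV. emeasure lborel (A j))"
proof -
  have Basis: "(Basis :: (real ^ 'm) set) = range (\<lambda>j. axis j 1)"
    by (auto simp: Basis_vec_def)
  have inj: "inj (\<lambda>j::'m. axis j (1::real))"
    by (auto simp: inj_on_def axis_eq_axis)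
  \<comment> \<open>The product formula for \<open>lborel\<close> is indexed by
    \<open>Basis\<close>, so the family \<open>A\<close> is transported along the bijection from
    \<open>j\<close> to \<open>axis j 1\<close>.\<close>
  define f where "f b = A (inv (\<lambda>j. axis j (1::real)) b)" for b
  have f: "f (axis j 1) = A j" for j
    unfolding f_def by (simp add: inv_f_f[OF inj])
  have [measurable]: "f b \<in> sets borel" for b by (simp add: f_def)
  have meas: "{s :: real ^ 'm. \<forall>j. s $ j \<in> A j} \<in> sets borel"
    by (rule vec_prod_borel) measurable
  have "emeasure lborel {s :: real ^ 'm. \<forall>j. s $ j \<in> A j}
    = (\<integral>\<^sup>+s. (\<Prod>b\<in>Basis. indicator (f b) (s \<bullet> b)) \<partial>(lborel :: (real ^ 'm) measure))"
    using meas
    by (subst nn_integral_indicator[symmetric], simp, intro nn_integral_cong)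
      (auto simp: Basis prod.reindex[OF inj] f inner_axis indicator_def)
  also have "\<dots> = (\<Prod>b\<in>Basis. emeasure lborel (f b))"
    by (subst nn_integral_lborel_prod) auto
  also have "\<dots> = (\<Prod>j\<in>UNIV. emeasure lborel (A j))"
    by (simp add: Basis prod.reindex[OF inj] f)
  finally show ?thesis .
qed

section \<open>The periodic extension and the linearly independent case\<close>

lemma joint_gcd_eq_1_iff:
  "joint_gcd p q = 1 \<longleftrightarrow> (\<forall>d. (\<forall>j. d dvd p $ j) \<and> (\<forall>i. d dvd q $ i) \<longrightarrow> is_unit d)"
proof -
  have "joint_gcd p q = 1 \<longleftrightarrow> is_unit (joint_gcd p q)"
    by (simp add: joint_gcd_def)
  also have "\<dots> \<longleftrightarrow> (\<forall>d. d dvd joint_gcd p q \<longrightarrow> is_unit d)"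
    by (meson dvd_refl dvd_unit_imp_unit)
  also have "\<dots> \<longleftrightarrow> (\<forall>d. (\<forall>j. d dvd p $ j) \<and> (\<forall>i. d dvd q $ i) \<longrightarrow> is_unit d)"
    by (simp add: joint_gcd_def dvd_Gcd_iff ball_Un)
  finally show ?thesis .
qed

text \<open>The vectors \<open>(p, q)\<close> and \<open>(p', q')\<close> are primitive and
  proportional, so comparing the gcds of \<open>b\<close> times the first and \<open>a\<close> times
  the second gives \<open>a = b\<close> or \<open>a = - b\<close>. Applied in contrapositive form,
  to find a coordinate where \<open>p\<close> and \<open>p'\<close> break the proportion.\<close>

lemma joint_gcd_parallel:
  fixes p p' :: "int ^ 'm" and q q' :: "int ^ 'n"
  assumes "joint_gcd p q = 1" "joint_gcd p' q' = 1"
    and p: "\<And>j. p $ j * b = p' $ j * a" and q: "\<And>i. q $ i * b = q' $ i * a" and b: "b \<noteq> 0"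
  shows "q = q' \<or> q = - q'"
proof -
  let ?s = "range (($) p) \<union> range (($) q)" and ?s' = "range (($) p') \<union> range (($) q')"
  have "(*) b ` ?s = (*) a ` ?s'"
    using p q by (auto simp: image_Un image_image mult.commute)
  then have "\<bar>b * Gcd ?s\<bar> = \<bar>a * Gcd ?s'\<bar>"
    by (metis Gcd_mult normalize_int_def abs_mult)
  then have ab: "\<bar>b\<bar> = \<bar>a\<bar>"
    using assms(1,2) by (simp add: joint_gcd_def)
  show ?thesis
  proof (cases "a = b")
    case True
    then show ?thesis using q b by (simp add: vec_eq_iff)
  next
    case False
    then have a: "a = - b" using ab by linarith
    have "(q $ i + q' $ i) * b = 0" for i using q[of i] by (simp add: a algebra_simps)
    then have "q = - q'" using b by (simp add: vec_eq_iff eq_neg_iff_add_eq_0)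
    then show ?thesis ..
  qed
qed

section \<open>The periodic extension of \<open>B'\<close>\<close>

lemma infnorm_less_iff_cart: "infnorm (v :: real ^ 'm) < \<delta> \<longleftrightarrow> (\<forall>j. \<bar>v $ j\<bar> < \<delta>)"
proof -
  have "infnorm v = Max (range (\<lambda>j. \<bar>v $ j\<bar>))"
    by (simp add: infnorm_cart cSup_eq_Max full_SetCompr_eq)
  then show ?thesis by (simp add: Max_less_iff)
qed

text \<open>The restriction to the cube is dropped so that averaging applies, and the sup norm is
  split into coordinates so that fibres can be compared with product sets.\<close>

definition B_ext :: "int ^ 'n \<Rightarrow> real \<Rightarrow> (real ^ 'm ^ 'n) set" where
  "B_ext q \<delta> = {X. \<exists>p :: int ^ 'm. joint_gcd p q = 1 \<and>
     (\<forall>j. \<bar>(real_vec q v* X) $ j + real_of_int (p $ j)\<bar> < \<delta>)}"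

lemma unit_cube_eq_cbox: "(unit_cube :: (real ^ 'm ^ 'n) set) = cbox 0 One"
proof -
  have One: "(One :: real ^ 'm ^ 'n) = (\<chi> i j. 1)"
  proof (rule euclidean_eqI)
    fix b :: "real ^ 'm ^ 'n" assume b: "b \<in> Basis"
    then have "(\<chi> i j. 1) \<bullet> b = 1" by (auto simp: Basis_vec_def inner_axis)
    then show "One \<bullet> b = (\<chi> i j. 1) \<bullet> b" by (simp only: inner_sum_Basis[OF b])
  qed
  show ?thesis
    unfolding One
    by (rule set_eqI) (force simp: unit_cube_def mem_box Basis_vec_def inner_axis)
qed

lemma B'_eq: "B' q \<delta> = B_ext q \<delta> \<inter> cbox 0 One"
  by (auto simp: B'_def B_ext_def infnorm_less_iff_cart unit_cube_eq_cbox real_vec_def)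

lemma B_ext_borel [measurable]: "(B_ext q \<delta> :: (real ^ 'm ^ 'n) set) \<in> sets borel"
proof -
  have "B_ext q \<delta> = (\<Union>p\<in>{p :: int ^ 'm. joint_gcd p q = 1}.
      \<Inter>j. {X :: real ^ 'm ^ 'n. \<bar>(real_vec q v* X) $ j + real_of_int (p $ j)\<bar> < \<delta>})"
    by (auto simp: B_ext_def)
  moreover have "open \<dots>"
    unfolding vector_matrix_mult_def
    by (intro open_UN ballI open_INT finite open_Collect_less continuous_intros)
  ultimately show ?thesis by (simp add: borel_open)
qed

lemma vector_matrix_mult_nth: "(q v* X) $ j = (\<Sum>i\<in>UNIV. q $ i * X $ i $ j)" for X :: "real ^ 'm ^ 'n"
  by (simp add: vector_matrix_mult_def mult.commute)

text \<open>An integer shift \<open>K\<close> changes \<open>q X\<close> by an integer vector, which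
  \<open>p'\<close> absorbs. As \<open>p' - p\<close> combines entries of \<open>q\<close>, every
  common divisor of \<open>p'\<close> and \<open>q\<close> divides \<open>p\<close>.\<close>

lemma periodic_B_ext: "periodic_set (B_ext q \<delta> :: (real ^ 'm ^ 'n) set)"
  unfolding periodic_set_def
proof safe
  fix K X :: "real ^ 'm ^ 'n" assume K: "K \<in> lattice" and X: "X \<in> B_ext q \<delta>"
  obtain p :: "int ^ 'm" where p: "joint_gcd p q = 1"
    "\<And>j. \<bar>(real_vec q v* X) $ j + real_of_int (p $ j)\<bar> < \<delta>"
    using X by (auto simp: B_ext_def)
  have "K $ i $ j \<in> \<int>" for i j
  proof -
    have "K \<bullet> axis i (axis j 1) \<in> \<int>"
      using K by (auto simp: lattice_def Basis_vec_def)
    then show ?thesis by (simp add: inner_axis)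
  qed
  then have K': "K $ i $ j = of_int \<lfloor>K $ i $ j\<rfloor>" for i j
    by (metis floor_of_int Ints_cases)
  define p' :: "int ^ 'm" where "p' = (\<chi> j. p $ j - (\<Sum>i\<in>UNIV. q $ i * \<lfloor>K $ i $ j\<rfloor>))"
  have "(real_vec q v* (X + K)) $ j + real_of_int (p' $ j) = (real_vec q v* X) $ j + real_of_int (p $ j)" for j
  proof -
    have "(real_vec q v* K) $ j = real_of_int (\<Sum>i\<in>UNIV. q $ i * \<lfloor>K $ i $ j\<rfloor>)"
      by (simp add: vector_matrix_mult_nth real_vec_def flip: K')
    then show ?thesis
      by (simp add: vector_matrix_mult_nth p'_def sum.distrib distrib_left)
  qed
  moreover have "joint_gcd p' q = 1"
  proof -
    have "(\<forall>j. d dvd p' $ j) \<and> (\<forall>i. d dvd q $ i) \<longrightarrow> (\<forall>j. d dvd p $ j)" for d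
      by (simp add: p'_def) (metis (no_types, lifting) diff_add_cancel dvd_add dvd_mult2 dvd_sum)
    then show ?thesis using p(1) unfolding joint_gcd_eq_1_iff by blast
  qed
  ultimately show "X + K \<in> B_ext q \<delta>"
    using p(2) unfolding B_ext_def by (intro CollectI exI[of _ p']) simp
qed

section \<open>Overlaps for linearly independent integer vectors\<close>

lemma periodic_Int: "periodic_set (S \<inter> T)" if "periodic_set S" "periodic_set T"
  using that by (auto simp: periodic_set_def)

text \<open>Translating \<open>X\<close> along this rank-one matrix moves \<open>q X\<close> by
  \<open>s\<close> times the inner product of \<open>q\<close> and \<open>u\<close>.\<close>

definition outer :: "real ^ 'n \<Rightarrow> real ^ 'm \<Rightarrow> real ^ 'm ^ 'n" where
  "outer u s = (\<chi> i j. u $ i * s $ j)"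

lemma mult_outer: "(q v* (X + outer u s)) $ j = (q v* X) $ j + (q \<bullet> u) * s $ j"
  by (simp add: vector_matrix_mult_nth outer_def inner_vec_def sum.distrib sum_distrib_left
      sum_distrib_right algebra_simps)

lemma outer_borel [measurable]: "outer u \<in> borel_measurable borel"
  unfolding outer_def by (intro borel_measurable_continuous_onI continuous_intros)

text \<open>For \<open>s\<close> in the unit interval and \<open>\<delta> < 1/2\<close>,
  \<open>p\<close> lies in an open interval of length 2. It thus takes at most two values, each
  allowing length \<open>2 * \<delta>\<close>.\<close>

lemma emeasure_near_int:
  assumes "0 < \<delta>" "\<delta> < 1/2"
  shows "emeasure lborel {s \<in> {0..1}. \<exists>p::int. \<bar>s + c + p\<bar> < \<delta>} \<le> ennreal (4 * \<delta>)"
proof -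
  \<comment> \<open>The least integer above \<open>- c - 3/2\<close>, the lower end of the interval
    containing \<open>p\<close>.\<close>
  define k where "k = \<lfloor>- c - 3/2\<rfloor> + 1"
  have "{s \<in> {0..1}. \<exists>p::int. \<bar>s + c + p\<bar> < \<delta>}
      \<subseteq> {- c - k - \<delta>..- c - k + \<delta>} \<union> {- c - (k + 1) - \<delta>..- c - (k + 1) + \<delta>}"
  proof safe
    fix s :: real and p :: int
    assume s: "s \<in> {0..1}" "\<bar>s + c + p\<bar> < \<delta>" "s \<notin> {- c - (k + 1) - \<delta>..- c - (k + 1) + \<delta>}"
    have "p \<noteq> k + 1" using s(2,3) by auto
    moreover have "k \<le> p" "p \<le> k + 1"
      using s assms unfolding k_def atLeastAtMost_iff by linarith+
    ultimately have "p = k" by linarith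
    then show "s \<in> {- c - k - \<delta>..- c - k + \<delta>}" using s(2) by auto
  qed
  then have "emeasure lborel {s \<in> {0..1}. \<exists>p::int. \<bar>s + c + p\<bar> < \<delta>}
    \<le> emeasure lborel ({- c - k - \<delta>..- c - k + \<delta>} \<union> {- c - (k + 1) - \<delta>..- c - (k + 1) + \<delta>})"
    by (intro emeasure_mono) auto
  also have "\<dots> \<le> emeasure lborel {- c - k - \<delta>..- c - k + \<delta>}
      + emeasure lborel {- c - (k + 1) - \<delta>..- c - (k + 1) + \<delta>}"
    by (rule emeasure_subadditive) auto
  also have "\<dots> = ennreal (4 * \<delta>)"
    using assms by (simp flip: ennreal_plus)
  finally show ?thesis .
qed

lemma cbox_0_One_nth: "s $ j \<in> {0..1}" if "s \<in> cbox 0 (One :: real ^ 'm)"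
proof -
  let ?e = "axis j 1 :: real ^ 'm"
  have e: "?e \<in> Basis" by (auto simp: Basis_vec_def)
  have "0 \<bullet> ?e \<le> s \<bullet> ?e \<and> s \<bullet> ?e \<le> One \<bullet> ?e"
    using that e unfolding mem_box by (rule bspec)
  then show ?thesis unfolding inner_sum_Basis[OF e] by (simp add: inner_axis)
qed

lemma emeasure_cbox_0_One: "emeasure lborel (cbox 0 (One :: 'a::euclidean_space)) = 1"
  by (simp add: emeasure_lborel_cbox_eq)

text \<open>Translating along two directions dual to \<open>q\<^sub>1\<close> and
  \<open>q\<^sub>2\<close> adds independent \<open>s\<close> and \<open>t\<close> to the two
  products, so each fibre lies in a product of two near-integer sets, bounded by
  \<open>emeasure_near_int\<close> in every coordinate.\<close>

lemma emeasure_B_independent: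
  fixes q\<^sub>1 q\<^sub>2 :: "int ^ 'n"
  assumes ne: "q\<^sub>1 $ i * q\<^sub>2 $ k \<noteq> q\<^sub>1 $ k * q\<^sub>2 $ i"
    and d: "0 < \<delta>\<^sub>1" "\<delta>\<^sub>1 < 1/2" "0 < \<delta>\<^sub>2" "\<delta>\<^sub>2 < 1/2"
  shows "emeasure lborel (B_ext q\<^sub>1 \<delta>\<^sub>1 \<inter> B_ext q\<^sub>2 \<delta>\<^sub>2 \<inter> cbox 0 (One :: real ^ 'm ^ 'n))
    \<le> ennreal ((16 * \<delta>\<^sub>1 * \<delta>\<^sub>2) ^ CARD('m))"
proof -
  define D where "D = real_of_int (q\<^sub>1 $ i * q\<^sub>2 $ k - q\<^sub>1 $ k * q\<^sub>2 $ i)"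
  have D: "D \<noteq> 0" using ne unfolding D_def of_int_eq_0_iff by simp
  \<comment> \<open>Cramer's rule on the nonzero minor \<open>D\<close> gives vectors dual to
    \<open>q\<^sub>1\<close> and \<open>q\<^sub>2\<close>.\<close>
  define u :: "real ^ 'n" where "u = (1 / D) *\<^sub>R (axis i (of_int (q\<^sub>2 $ k)) - axis k (of_int (q\<^sub>2 $ i)))"
  define v :: "real ^ 'n" where "v = (1 / D) *\<^sub>R (axis k (of_int (q\<^sub>1 $ i)) - axis i (of_int (q\<^sub>1 $ k)))"
  have uv: "real_vec q\<^sub>1 \<bullet> u = 1" "real_vec q\<^sub>2 \<bullet> u = 0" "real_vec q\<^sub>1 \<bullet> v = 0" "real_vec q\<^sub>2 \<bullet> v = 1"
    using D by (simp_all add: u_def v_def inner_diff_right inner_axis real_vec_def)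
      (simp_all add: D_def field_simps)
  define L :: "(real ^ 'm) \<times> (real ^ 'm) \<Rightarrow> real ^ 'm ^ 'n" where
    "L = (\<lambda>st. outer u (fst st) + outer v (snd st))"
  have L [measurable]: "L \<in> borel_measurable borel"
    unfolding L_def outer_def by (intro borel_measurable_continuous_onI continuous_intros)
  define P :: "((real ^ 'm) \<times> (real ^ 'm)) set" where "P = cbox 0 One \<times> cbox 0 One"
  have P_eq: "P = cbox (0, 0) (One, One)" by (simp add: P_def cbox_Pair_eq)
  have P [measurable]: "P \<in> sets borel" unfolding P_eq by simp
  have eP: "emeasure lborel P = 1"
    unfolding P_def
    by (simp add: lborel_prod[symmetric] lborel.emeasure_pair_measure_Times emeasure_cbox_0_One)
  show ?thesis
  proof (rule emeasure_periodic_le[OF _ P L _ eP])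
    show "B_ext q\<^sub>1 \<delta>\<^sub>1 \<inter> B_ext q\<^sub>2 \<delta>\<^sub>2 \<in> sets borel" by measurable
    show "periodic_set (B_ext q\<^sub>1 \<delta>\<^sub>1 \<inter> B_ext q\<^sub>2 \<delta>\<^sub>2)" by (intro periodic_Int periodic_B_ext)
    fix X :: "real ^ 'm ^ 'n"
    define A where "A q \<delta> j = {s \<in> {0..1}. \<exists>p::int. \<bar>s + (real_vec q v* X) $ j + p\<bar> < \<delta>}" for q \<delta> j
    have A [measurable]: "A q \<delta> j \<in> sets borel" for q \<delta> j
      unfolding A_def by measurable
    define E where "E q \<delta> = {s :: real ^ 'm. \<forall>j. s $ j \<in> A q \<delta> j}" for q \<delta>
    have E [measurable]: "E q \<delta> \<in> sets borel" for q \<delta>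
      unfolding E_def by (rule vec_prod_borel) measurable
    have mE: "emeasure lborel (E q \<delta>) \<le> ennreal ((4 * \<delta>) ^ CARD('m))" if "0 < \<delta>" "\<delta> < 1/2" for q \<delta>
    proof -
      have "emeasure lborel (E q \<delta>) = (\<Prod>j\<in>UNIV. emeasure lborel (A q \<delta> j))"
        unfolding E_def by (rule emeasure_lborel_vec_prod) measurable
      also have "\<dots> \<le> (\<Prod>j\<in>(UNIV :: 'm set). ennreal (4 * \<delta>))"
        unfolding A_def by (intro prod_mono_ennreal emeasure_near_int that)
      also have "\<dots> = ennreal ((4 * \<delta>) ^ CARD('m))"
        using that by (simp add: ennreal_power)
      finally show ?thesis .
    qed
    have sub: "{st \<in> P. X + L st \<in> B_ext q\<^sub>1 \<delta>\<^sub>1 \<inter> B_ext q\<^sub>2 \<delta>\<^sub>2} \<subseteq> E q\<^sub>1 \<delta>\<^sub>1 \<times> E q\<^sub>2 \<delta>\<^sub>2"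
    proof safe
      fix s t assume st: "(s, t) \<in> P" "X + L (s, t) \<in> B_ext q\<^sub>1 \<delta>\<^sub>1" "X + L (s, t) \<in> B_ext q\<^sub>2 \<delta>\<^sub>2"
      have "(real_vec q\<^sub>1 v* (X + L (s, t))) $ j = s $ j + (real_vec q\<^sub>1 v* X) $ j"
        "(real_vec q\<^sub>2 v* (X + L (s, t))) $ j = t $ j + (real_vec q\<^sub>2 v* X) $ j" for j
        by (simp_all add: L_def mult_outer uv flip: add.assoc)
      moreover have "s \<in> cbox 0 One" "t \<in> cbox 0 One"
        using st(1) by (simp_all only: P_def mem_Sigma_iff)
      note this[THEN cbox_0_One_nth]
      ultimately show "s \<in> E q\<^sub>1 \<delta>\<^sub>1" "t \<in> E q\<^sub>2 \<delta>\<^sub>2"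
        using st(2,3) unfolding B_ext_def E_def A_def mem_Collect_eq by (metis (no_types, lifting))+
    qed
    have "emeasure lborel {st \<in> P. X + L st \<in> B_ext q\<^sub>1 \<delta>\<^sub>1 \<inter> B_ext q\<^sub>2 \<delta>\<^sub>2}
        \<le> emeasure lborel (E q\<^sub>1 \<delta>\<^sub>1 \<times> E q\<^sub>2 \<delta>\<^sub>2)"
      by (rule emeasure_mono[OF sub]) (simp add: borel_prod[symmetric])
    also have "\<dots> = emeasure lborel (E q\<^sub>1 \<delta>\<^sub>1) * emeasure lborel (E q\<^sub>2 \<delta>\<^sub>2)"
      by (simp add: lborel_prod[symmetric] lborel.emeasure_pair_measure_Times)
    also have "\<dots> \<le> ennreal ((4 * \<delta>\<^sub>1) ^ CARD('m)) * ennreal ((4 * \<delta>\<^sub>2) ^ CARD('m))"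
      by (intro mult_mono mE d) auto
    also have "\<dots> = ennreal ((16 * \<delta>\<^sub>1 * \<delta>\<^sub>2) ^ CARD('m))"
    proof -
      have "(4 * \<delta>\<^sub>1) ^ CARD('m) * (4 * \<delta>\<^sub>2) ^ CARD('m) = (4 * \<delta>\<^sub>1 * (4 * \<delta>\<^sub>2)) ^ CARD('m)"
        by (rule power_mult_distrib[symmetric])
      also have "4 * \<delta>\<^sub>1 * (4 * \<delta>\<^sub>2) = 16 * \<delta>\<^sub>1 * \<delta>\<^sub>2" by simp
      finally show ?thesis using d by (subst ennreal_mult[symmetric]) auto
    qed
    finally show "emeasure lborel {st \<in> P. X + L st \<in> B_ext q\<^sub>1 \<delta>\<^sub>1 \<inter> B_ext q\<^sub>2 \<delta>\<^sub>2}
        \<le> ennreal ((16 * \<delta>\<^sub>1 * \<delta>\<^sub>2) ^ CARD('m))" .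
  qed
qed

section \<open>The parallel case\<close>

lemma card_int_ball:
  fixes r z :: real
  assumes "r > 0"
  shows "finite {i::int. \<bar>real_of_int i - z\<bar> < r}" "real (card {i::int. \<bar>real_of_int i - z\<bar> < r}) \<le> 2 * r + 1"
proof -
  have sub: "{i::int. \<bar>real_of_int i - z\<bar> < r} \<subseteq> {\<lfloor>z - r\<rfloor> + 1..\<lceil>z + r\<rceil> - 1}"
    by safe (simp_all, linarith+)
  then show "finite {i::int. \<bar>real_of_int i - z\<bar> < r}" by (rule finite_subset) simp
  have "card {i::int. \<bar>real_of_int i - z\<bar> < r} \<le> card {\<lfloor>z - r\<rfloor> + 1..\<lceil>z + r\<rceil> - 1}"
    by (rule card_mono[OF _ sub]) simp
  also have "\<dots> = nat (\<lceil>z + r\<rceil> - 1 - \<lfloor>z - r\<rfloor>)" by simp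
  finally show "real (card {i::int. \<bar>real_of_int i - z\<bar> < r}) \<le> 2 * r + 1"
    using assms by linarith
qed

text \<open>
  The pair \<open>(p, p')\<close> is determined by the multiple \<open>p b' - p' a'\<close> and by the block of length
  \<open>\<bar>a'\<bar>\<close> containing \<open>p\<close>, where \<open>a = g a'\<close>, \<open>b = g b'\<close>.
\<close>
lemma card_close_pairs:
  fixes a b :: int
  defines "g \<equiv> gcd a b"
  assumes ab: "a \<noteq> 0" "b \<noteq> 0" and \<Delta>: "real_of_int g < \<Delta>"
    and F: "\<And>p p'. (p, p') \<in> F \<Longrightarrow> \<bar>of_int (p * b - p' * a)\<bar> < \<Delta> \<and> \<bar>of_int p - z\<bar> < real_of_int \<bar>a\<bar>"
  shows "finite F" "real (card F) \<le> 12 * \<Delta>"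
proof -
  obtain a' b' where a': "a = g * a'" and b': "b = g * b'" and cop: "coprime a' b'"
    unfolding g_def by (metis gcd_coprime_exists ab(1) gcd_eq_0_iff mult.commute)
  have g: "g > 0" using ab by (simp add: g_def)
  have "a' \<noteq> 0" using a' ab by auto
  define R where "R = \<Delta> / g"
  have R: "R > 1" using \<Delta> g by (simp add: R_def)
  \<comment> \<open>Rounding down subtracts an amount in [0, 1); moving the centre down by 1/2
    reduces the error to at most 1/2, whence the radius \<open>g + 1/2\<close> for block
    indices.\<close>
  define w where "w = z / \<bar>a'\<bar> - 1/2"
  define f where "f = (\<lambda>(p, p'). (p * b' - p' * a', p div \<bar>a'\<bar>))"
  let ?T = "{i::int. \<bar>real_of_int i - 0\<bar> < R} \<times> {i::int. \<bar>real_of_int i - w\<bar> < g + 1/2}"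
  have sub: "f ` F \<subseteq> ?T"
  proof
    fix y assume "y \<in> f ` F"
    then obtain p p' where y: "y = f (p, p')" and pp: "(p, p') \<in> F" by auto
    have "real_of_int (p * b - p' * a) = g * real_of_int (p * b' - p' * a')"
      by (subst a', subst b') (simp add: algebra_simps)
    then have 1: "\<bar>real_of_int (p * b' - p' * a')\<bar> < R"
      using F[OF pp] g by (simp only: R_def abs_mult) (simp add: field_simps)
    have "\<bar>of_int p / \<bar>a'\<bar> - z / \<bar>a'\<bar>\<bar> = \<bar>of_int p - z\<bar> / \<bar>a'\<bar>"
      by (simp add: diff_divide_distrib[symmetric] abs_divide)
    also have "\<dots> < real_of_int \<bar>a\<bar> / \<bar>a'\<bar>"
      using F[OF pp] \<open>a' \<noteq> 0\<close> by (intro divide_strict_right_mono) auto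
    also have "real_of_int \<bar>a\<bar> / \<bar>a'\<bar> = g"
      using g \<open>a' \<noteq> 0\<close> by (simp add: a' abs_mult)
    finally have 2: "\<bar>of_int p / \<bar>a'\<bar> - z / \<bar>a'\<bar>\<bar> < g" .
    have "p div \<bar>a'\<bar> = \<lfloor>of_int p / real_of_int \<bar>a'\<bar>\<rfloor>"
      by (rule floor_divide_of_int_eq[symmetric])
    then have "\<bar>of_int (p div \<bar>a'\<bar>) - w\<bar> < g + 1/2"
      using 2 unfolding w_def by linarith
    then show "y \<in> ?T" using 1 by (simp add: y f_def)
  qed
  have inj: "inj_on f F"
  proof (rule inj_onI, clarify)
    fix p p' r r' assume "f (p, p') = f (r, r')"
    then have eq: "p * b' - p' * a' = r * b' - r' * a'" "p div \<bar>a'\<bar> = r div \<bar>a'\<bar>"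
      by (auto simp: f_def)
    have "(p - r) * b' = (p' - r') * a'" using eq(1) by (simp add: algebra_simps)
    then have "a' dvd p - r"
      using cop by (metis coprime_dvd_mult_left_iff dvd_triv_right)
    then have "p mod \<bar>a'\<bar> = r mod \<bar>a'\<bar>" by (simp add: mod_eq_dvd_iff)
    then have "p = r" using eq(2) by (metis div_mult_mod_eq)
    then show "p = r \<and> p' = r'" using eq(1) \<open>a' \<noteq> 0\<close> by simp
  qed
  have fin: "finite ?T"
    using R g by (intro finite_cartesian_product card_int_ball) auto
  show "finite F" using inj_on_finite[OF inj sub fin] .
  have "card F \<le> card ?T" by (rule card_inj_on_le[OF inj sub fin])
  then have "real (card F) \<le> real (card {i::int. \<bar>real_of_int i - 0\<bar> < R}) * real (card {i::int. \<bar>real_of_int i - w\<bar> < g + 1/2})"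
    by (metis card_cartesian_product of_nat_le_iff of_nat_mult)
  also have "\<dots> \<le> (2 * R + 1) * (2 * (g + 1/2) + 1)"
    using g R by (intro mult_mono card_int_ball) auto
  \<comment> \<open>\<open>R > 1\<close> and \<open>g \<ge> 1\<close> absorb the additive constants.
    The first is the hypothesis that the gcd is below \<open>\<Delta>\<close>; without it the count
    could not be linear in \<open>\<Delta>\<close>.\<close>
  also have "\<dots> \<le> (3 * R) * (4 * g)"
    using g R by (intro mult_mono) auto
  also have "\<dots> = 12 * \<Delta>" using g by (simp add: R_def)
  finally show "real (card F) \<le> 12 * \<Delta>" .
qed

section \<open>Overlaps for parallel integer vectors\<close>

lemma emeasure_affine_less:
  fixes a c \<delta> :: real
  assumes "a \<noteq> 0" "0 < \<delta>"
  shows "emeasure lborel {s. \<bar>a * s + c\<bar> < \<delta>} = ennreal (2 * \<delta> / \<bar>a\<bar>)"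
proof -
  have "\<bar>a * s + c\<bar> = \<bar>a\<bar> * \<bar>s + c / a\<bar>" for s
    using assms by (simp flip: abs_mult add: distrib_left)
  then have "{s. \<bar>a * s + c\<bar> < \<delta>} = {s. \<bar>s + c / a\<bar> < \<delta> / \<bar>a\<bar>}"
    using assms by (simp add: field_simps)
  also have "\<dots> = {- c / a - \<delta> / \<bar>a\<bar><..<- c / a + \<delta> / \<bar>a\<bar>}"
    by (auto simp: abs_less_iff)
  finally show ?thesis using assms by simp
qed

text \<open>Eliminating \<open>s\<close> from the two inequalities bounds
  \<open>p * b - p' * a\<close> by \<open>\<Delta>\<close>, so \<open>card_close_pairs\<close>
  leaves at most \<open>12 * \<Delta>\<close> pairs. Each pair contributes at most the shorter of
  two intervals, of length \<open>\<mu>\<close>.\<close>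

lemma emeasure_parallel_overlap:
  fixes a b :: int and c\<^sub>1 c\<^sub>2 \<delta>\<^sub>1 \<delta>\<^sub>2 :: real
  assumes ab: "a \<noteq> 0" "b \<noteq> 0" and c: "b * c\<^sub>1 = a * c\<^sub>2"
    and d: "0 < \<delta>\<^sub>1" "\<delta>\<^sub>1 < 1/2" "0 < \<delta>\<^sub>2" "\<delta>\<^sub>2 < 1/2"
    and gcd: "real_of_int (gcd a b) < \<bar>b\<bar> * \<delta>\<^sub>1 + \<bar>a\<bar> * \<delta>\<^sub>2"
  shows "emeasure lborel {s \<in> {0..1::real}. \<exists>(p::int) (p'::int). \<bar>real_of_int a * s + c\<^sub>1 + p\<bar> < \<delta>\<^sub>1 \<and> \<bar>real_of_int b * s + c\<^sub>2 + p'\<bar> < \<delta>\<^sub>2}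
    \<le> ennreal (48 * \<delta>\<^sub>1 * \<delta>\<^sub>2)"
proof -
  define F where "F = {(p::int, p'::int). \<exists>s\<in>{0..1::real}. \<bar>real_of_int a * s + c\<^sub>1 + p\<bar> < \<delta>\<^sub>1 \<and> \<bar>real_of_int b * s + c\<^sub>2 + p'\<bar> < \<delta>\<^sub>2}"
  define I where "I = (\<lambda>(p::int, p'::int). {s::real. \<bar>real_of_int a * s + (c\<^sub>1 + p)\<bar> < \<delta>\<^sub>1 \<and> \<bar>real_of_int b * s + (c\<^sub>2 + p')\<bar> < \<delta>\<^sub>2})"
  have I: "I pp \<in> sets borel" for pp
    unfolding I_def by (cases pp) simp
  define \<Delta> where "\<Delta> = \<bar>b\<bar> * \<delta>\<^sub>1 + \<bar>a\<bar> * \<delta>\<^sub>2"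
  define \<mu> where "\<mu> = min (2 * \<delta>\<^sub>1 / \<bar>a\<bar>) (2 * \<delta>\<^sub>2 / \<bar>b\<bar>)"
  have key: "\<bar>of_int (p * b - p' * a)\<bar> < \<Delta> \<and> \<bar>of_int p - (- c\<^sub>1 - a / 2)\<bar> < real_of_int \<bar>a\<bar>"
    if pp: "(p, p') \<in> F" for p p'
  proof
    obtain s :: real where s: "s \<in> {0..1}" "\<bar>real_of_int a * s + c\<^sub>1 + p\<bar> < \<delta>\<^sub>1" "\<bar>real_of_int b * s + c\<^sub>2 + p'\<bar> < \<delta>\<^sub>2"
      using pp by (auto simp: F_def)
    have "of_int (p * b - p' * a) = real_of_int b * (real_of_int a * s + c\<^sub>1 + p) - real_of_int a * (real_of_int b * s + c\<^sub>2 + p')"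
      using c by (simp add: algebra_simps)
    also have "\<bar>\<dots>\<bar> \<le> \<bar>real_of_int b\<bar> * \<bar>real_of_int a * s + c\<^sub>1 + p\<bar> + \<bar>real_of_int a\<bar> * \<bar>real_of_int b * s + c\<^sub>2 + p'\<bar>"
      by (rule order_trans[OF abs_triangle_ineq4]) (simp add: abs_mult)
    also have "\<dots> < \<bar>real_of_int b\<bar> * \<delta>\<^sub>1 + \<bar>real_of_int a\<bar> * \<delta>\<^sub>2"
      using s ab by (intro add_strict_mono mult_strict_left_mono) auto
    finally show "\<bar>of_int (p * b - p' * a)\<bar> < \<Delta>" by (simp add: \<Delta>_def)
    \<comment> \<open>\<open>p\<close> is within \<open>\<delta>\<^sub>1 < 1/2\<close> of
      \<open>- c\<^sub>1 - a * s\<close>, and \<open>a * s\<close> is within half of the absolute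
      value of \<open>a\<close> from \<open>a / 2\<close>. As that absolute value is at least 1, the
      two errors together stay below it.\<close>
    have "\<bar>real_of_int a * (s - 1/2)\<bar> \<le> \<bar>real_of_int a\<bar> * (1/2)"
      unfolding abs_mult using s(1) by (intro mult_left_mono) (auto simp: abs_if)
    then have "\<bar>real_of_int a * s - a / 2\<bar> \<le> \<bar>real_of_int a\<bar> / 2" by (simp add: algebra_simps)
    moreover have "\<bar>real_of_int a\<bar> \<ge> 1" using ab by linarith
    ultimately show "\<bar>of_int p - (- c\<^sub>1 - a / 2)\<bar> < real_of_int \<bar>a\<bar>"
      using s(2) d(2) by linarith
  qed
  have F: "finite F" "real (card F) \<le> 12 * \<Delta>"
    by (rule card_close_pairs[OF ab gcd[folded \<Delta>_def]], erule key)+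
  have "emeasure lborel (I pp) \<le> ennreal \<mu>" for pp
  proof -
    obtain p p' where pp: "pp = (p, p')" by (cases pp)
    have "emeasure lborel (I pp) \<le> emeasure lborel {s. \<bar>real_of_int a * s + (c\<^sub>1 + p)\<bar> < \<delta>\<^sub>1}"
      "emeasure lborel (I pp) \<le> emeasure lborel {s. \<bar>real_of_int b * s + (c\<^sub>2 + p')\<bar> < \<delta>\<^sub>2}"
      by (rule emeasure_mono; auto simp: I_def pp)+
    then show ?thesis
      using ab d by (simp add: emeasure_affine_less \<mu>_def min_def)
  qed
  note I_le = this
  have "emeasure lborel {s \<in> {0..1::real}. \<exists>(p::int) (p'::int). \<bar>real_of_int a * s + c\<^sub>1 + p\<bar> < \<delta>\<^sub>1 \<and> \<bar>real_of_int b * s + c\<^sub>2 + p'\<bar> < \<delta>\<^sub>2}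
      \<le> emeasure lborel (\<Union>(I ` F))"
  proof (rule emeasure_mono)
    show "{s \<in> {0..1::real}. \<exists>(p::int) (p'::int). \<bar>real_of_int a * s + c\<^sub>1 + p\<bar> < \<delta>\<^sub>1 \<and> \<bar>real_of_int b * s + c\<^sub>2 + p'\<bar> < \<delta>\<^sub>2} \<subseteq> \<Union>(I ` F)"
    proof safe
      fix s :: real and p p' :: int
      assume "s \<in> {0..1}" "\<bar>real_of_int a * s + c\<^sub>1 + p\<bar> < \<delta>\<^sub>1" "\<bar>real_of_int b * s + c\<^sub>2 + p'\<bar> < \<delta>\<^sub>2"
      then have "(p, p') \<in> F" "s \<in> I (p, p')"
        unfolding F_def I_def by (blast, simp add: add.assoc)
      then show "s \<in> \<Union>(I ` F)" by blast
    qed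
    show "\<Union>(I ` F) \<in> sets lborel" using F(1) I by (auto intro!: sets.finite_UN)
  qed
  also have "\<dots> \<le> (\<Sum>pp\<in>F. emeasure lborel (I pp))"
    using F(1) I by (intro emeasure_subadditive_finite) auto
  also have "\<dots> \<le> (\<Sum>pp\<in>F. ennreal \<mu>)"
    by (intro sum_mono I_le)
  also have "\<dots> = ennreal (real (card F) * \<mu>)"
    by (simp add: ennreal_mult' ennreal_of_nat_eq_real_of_nat)
  also have "\<dots> \<le> ennreal (12 * \<Delta> * \<mu>)"
    using F(2) d by (intro ennreal_leI mult_right_mono) (auto simp: \<mu>_def)
  also have "\<dots> \<le> ennreal (48 * \<delta>\<^sub>1 * \<delta>\<^sub>2)"
  proof (rule ennreal_leI)
    \<comment> \<open>Each summand of \<open>\<Delta>\<close> is paired with the bound in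
      \<open>\<mu>\<close> that cancels its integer factor, leaving
      \<open>2 * \<delta>\<^sub>1 * \<delta>\<^sub>2\<close> twice.\<close>
    have "\<bar>b\<bar> * \<delta>\<^sub>1 * \<mu> \<le> \<bar>b\<bar> * \<delta>\<^sub>1 * (2 * \<delta>\<^sub>2 / \<bar>b\<bar>)" "\<bar>a\<bar> * \<delta>\<^sub>2 * \<mu> \<le> \<bar>a\<bar> * \<delta>\<^sub>2 * (2 * \<delta>\<^sub>1 / \<bar>a\<bar>)"
      using d by (intro mult_left_mono; simp add: \<mu>_def)+
    then show "12 * \<Delta> * \<mu> \<le> 48 * \<delta>\<^sub>1 * \<delta>\<^sub>2"
      using ab unfolding \<Delta>_def by (simp add: algebra_simps)
  qed
  finally show ?thesis .
qed

text \<open>Moving row \<open>i\<close> of \<open>X\<close> by \<open>s\<close> moves the two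
  products by \<open>q\<^sub>1 $ i\<close> and \<open>q\<^sub>2 $ i\<close> times \<open>s\<close>,
  so the fibre lies in a product of one-dimensional overlaps.\<close>

lemma emeasure_B_parallel:
  fixes q\<^sub>1 q\<^sub>2 :: "int ^ 'n"
  assumes par: "\<And>k. q\<^sub>1 $ k * q\<^sub>2 $ i = q\<^sub>2 $ k * q\<^sub>1 $ i"
    and nz: "q\<^sub>1 $ i \<noteq> 0" "q\<^sub>2 $ i \<noteq> 0" and ne: "q\<^sub>1 \<noteq> q\<^sub>2" "q\<^sub>1 \<noteq> - q\<^sub>2"
    and d: "0 < \<delta>\<^sub>1" "\<delta>\<^sub>1 < 1/2" "0 < \<delta>\<^sub>2" "\<delta>\<^sub>2 < 1/2"
  shows "emeasure lborel (B_ext q\<^sub>1 \<delta>\<^sub>1 \<inter> B_ext q\<^sub>2 \<delta>\<^sub>2 \<inter> cbox 0 (One :: real ^ 'm ^ 'n))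
    \<le> ennreal ((48 * \<delta>\<^sub>1 * \<delta>\<^sub>2) ^ CARD('m))"
proof (rule emeasure_periodic_le[OF _ _ outer_borel[of "axis i 1"] _ emeasure_cbox_0_One])
  show "B_ext q\<^sub>1 \<delta>\<^sub>1 \<inter> B_ext q\<^sub>2 \<delta>\<^sub>2 \<in> sets borel" by measurable
  show "periodic_set (B_ext q\<^sub>1 \<delta>\<^sub>1 \<inter> B_ext q\<^sub>2 \<delta>\<^sub>2)" by (intro periodic_Int periodic_B_ext)
  show "cbox 0 One \<in> sets borel" by simp
  fix X :: "real ^ 'm ^ 'n"
  let ?a = "q\<^sub>1 $ i" and ?b = "q\<^sub>2 $ i"
  let ?c\<^sub>1 = "\<lambda>j. (real_vec q\<^sub>1 v* X) $ j" and ?c\<^sub>2 = "\<lambda>j. (real_vec q\<^sub>2 v* X) $ j"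
  have c: "?b * ?c\<^sub>1 j = ?a * ?c\<^sub>2 j" for j
  proof -
    have "real_of_int ?b * real_of_int (q\<^sub>1 $ k) = real_of_int ?a * real_of_int (q\<^sub>2 $ k)" for k
      using par[of k] by (metis mult.commute of_int_mult)
    then show ?thesis
      by (simp add: vector_matrix_mult_nth sum_distrib_left real_vec_def mult.assoc[symmetric])
  qed
  have shift: "(real_vec q v* (X + outer (axis i 1) s)) $ j = q $ i * s $ j + (real_vec q v* X) $ j" for q s j
    by (simp add: mult_outer inner_axis real_vec_def)
  define E where "E j = {s \<in> {0..1::real}. \<exists>(p::int) (p'::int). \<bar>real_of_int ?a * s + ?c\<^sub>1 j + p\<bar> < \<delta>\<^sub>1 \<and> \<bar>real_of_int ?b * s + ?c\<^sub>2 j + p'\<bar> < \<delta>\<^sub>2}" for j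
  have E [measurable]: "E j \<in> sets borel" for j
    unfolding E_def by measurable
  let ?S = "{s \<in> cbox 0 One. X + outer (axis i 1) s \<in> B_ext q\<^sub>1 \<delta>\<^sub>1 \<inter> B_ext q\<^sub>2 \<delta>\<^sub>2}"
  show "emeasure lborel ?S \<le> ennreal ((48 * \<delta>\<^sub>1 * \<delta>\<^sub>2) ^ CARD('m))"
  proof (cases "?S = {}")
    case False
    then obtain s where s: "X + outer (axis i 1) s \<in> B_ext q\<^sub>1 \<delta>\<^sub>1" "X + outer (axis i 1) s \<in> B_ext q\<^sub>2 \<delta>\<^sub>2"
      by blast
    obtain p p' :: "int ^ 'm" where p: "joint_gcd p q\<^sub>1 = 1" "\<And>j. \<bar>real_of_int ?a * s $ j + ?c\<^sub>1 j + p $ j\<bar> < \<delta>\<^sub>1"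
      and p': "joint_gcd p' q\<^sub>2 = 1" "\<And>j. \<bar>real_of_int ?b * s $ j + ?c\<^sub>2 j + p' $ j\<bar> < \<delta>\<^sub>2"
      using s unfolding B_ext_def mem_Collect_eq shift by blast
    \<comment> \<open>One point of a nonempty fibre is enough: this \<open>j\<close> yields a
      nonzero multiple of the gcd below the threshold. The resulting inequality does not involve
      \<open>j\<close>, so it serves all coordinates afterwards.\<close>
    obtain j where j: "p $ j * ?b \<noteq> p' $ j * ?a"
      using joint_gcd_parallel[OF p(1) p'(1) _ par nz(2)] ne by blast
    have "gcd ?a ?b dvd p $ j * ?b - p' $ j * ?a" by simp
    then have "gcd ?a ?b \<le> \<bar>p $ j * ?b - p' $ j * ?a\<bar>"
      using j by (intro zdvd_imp_le) auto
    then have "real_of_int (gcd ?a ?b) \<le> \<bar>real_of_int (p $ j * ?b - p' $ j * ?a)\<bar>"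
      by (metis of_int_abs of_int_le_iff)
    also have "real_of_int (p $ j * ?b - p' $ j * ?a)
        = real_of_int ?b * (real_of_int ?a * s $ j + ?c\<^sub>1 j + p $ j) - real_of_int ?a * (real_of_int ?b * s $ j + ?c\<^sub>2 j + p' $ j)"
      using c[of j] by (simp add: algebra_simps)
    also have "\<bar>\<dots>\<bar> \<le> \<bar>real_of_int ?b\<bar> * \<bar>real_of_int ?a * s $ j + ?c\<^sub>1 j + p $ j\<bar>
        + \<bar>real_of_int ?a\<bar> * \<bar>real_of_int ?b * s $ j + ?c\<^sub>2 j + p' $ j\<bar>"
      by (rule order_trans[OF abs_triangle_ineq4]) (simp add: abs_mult)
    also have "\<dots> < \<bar>real_of_int ?b\<bar> * \<delta>\<^sub>1 + \<bar>real_of_int ?a\<bar> * \<delta>\<^sub>2"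
      using p(2) p'(2) nz by (intro add_strict_mono mult_strict_left_mono) auto
    finally have gcd: "real_of_int (gcd ?a ?b) < \<bar>?b\<bar> * \<delta>\<^sub>1 + \<bar>?a\<bar> * \<delta>\<^sub>2" by simp
    have meas: "{s :: real ^ 'm. \<forall>j. s $ j \<in> E j} \<in> sets borel"
      by (rule vec_prod_borel) measurable
    have "?S \<subseteq> {s. \<forall>j. s $ j \<in> E j}"
    proof safe
      fix s j assume s: "s \<in> cbox 0 One" "X + outer (axis i 1) s \<in> B_ext q\<^sub>1 \<delta>\<^sub>1"
        "X + outer (axis i 1) s \<in> B_ext q\<^sub>2 \<delta>\<^sub>2"
      show "s $ j \<in> E j"
        using s(2,3) cbox_0_One_nth[OF s(1), of j]
        unfolding B_ext_def E_def mem_Collect_eq shift by blast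
    qed
    then have "emeasure lborel ?S \<le> emeasure lborel {s :: real ^ 'm. \<forall>j. s $ j \<in> E j}"
      using meas by (intro emeasure_mono) auto
    also have "\<dots> = (\<Prod>j\<in>UNIV. emeasure lborel (E j))"
      by (rule emeasure_lborel_vec_prod) measurable
    also have "\<dots> \<le> (\<Prod>j\<in>(UNIV :: 'm set). ennreal (48 * \<delta>\<^sub>1 * \<delta>\<^sub>2))"
      unfolding E_def by (intro prod_mono_ennreal emeasure_parallel_overlap nz c d gcd)
    also have "\<dots> = ennreal ((48 * \<delta>\<^sub>1 * \<delta>\<^sub>2) ^ CARD('m))"
      using d by (simp add: ennreal_power)
    finally show ?thesis .
  next
    case True
    then show ?thesis by (simp only: emeasure_empty zero_le)
  qed
qed

section \<open>Lower bounds by counting coprime pairs\<close>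

lemma bij_betw_vec_lambda:
  "bij_betw vec_lambda (PiE UNIV A) {p :: 'a ^ 'k. \<forall>j. p $ j \<in> A j}"
  by (rule bij_betwI[where g = vec_nth]) auto

lemma card_vec_prod:
  fixes A :: "'k::finite \<Rightarrow> 'a set"
  shows "card {p :: 'a ^ 'k. \<forall>j. p $ j \<in> A j} = (\<Prod>j\<in>UNIV. card (A j))"
  using bij_betw_same_card[OF bij_betw_vec_lambda[of A]] by (simp add: card_PiE)

lemma finite_vec_prod:
  fixes A :: "'k::finite \<Rightarrow> 'a set"
  assumes "\<And>j. finite (A j)"
  shows "finite {p :: 'a ^ 'k. \<forall>j. p $ j \<in> A j}"
  using bij_betw_finite[OF bij_betw_vec_lambda[of A]] assms by (simp add: finite_PiE)

text \<open>One representative per class modulo \<open>h\<close>. If \<open>h\<close> is an entry of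
  \<open>q\<close>, joint coprimality depends only on the class of \<open>p\<close>.\<close>

definition coprime_residues :: "nat \<Rightarrow> int ^ 'n \<Rightarrow> (int ^ 'm) set" where
  "coprime_residues h q = {p. (\<forall>j. p $ j \<in> {1..int h}) \<and> joint_gcd p q = 1}"

lemma finite_coprime_residues: "finite (coprime_residues h q)"
proof (rule finite_subset)
  show "coprime_residues h q \<subseteq> {p. \<forall>j. p $ j \<in> {1..int h}}" by (auto simp: coprime_residues_def)
qed (rule finite_vec_prod, simp)

text \<open>Moving row \<open>i\<close> shifts \<open>q X\<close> by \<open>h * s\<close>, so each
  coprime class contributes a cube of side \<open>2 * \<delta> / h\<close> to the fibre. Cubes of
  different classes are disjoint because \<open>\<delta> < 1/2\<close>.\<close>

lemma emeasure_B_ge: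
  fixes q :: "int ^ 'n"
  assumes qi: "q $ i = int h" and h: "h \<ge> 1" and d: "0 < \<delta>" "\<delta> < 1/2"
  shows "ennreal ((2 * \<delta> / h) ^ CARD('m) * card (coprime_residues h q :: (int ^ 'm) set))
    \<le> ennreal (2 ^ CARD('m)) * emeasure lborel (B_ext q \<delta> \<inter> cbox 0 (One :: real ^ 'm ^ 'n))"
proof -
  \<comment> \<open>a window of length 2 contains an unwrapped copy of every interval modulo 1\<close>
  define P :: "(real ^ 'm) set" where "P = {s. \<forall>j. s $ j \<in> {0..2}}"
  have P: "P \<in> sets borel"
    unfolding P_def by (rule vec_prod_borel) measurable
  have eP: "emeasure lborel P = ennreal (2 ^ CARD('m))"
    unfolding P_def by (subst emeasure_lborel_vec_prod) (auto simp flip: ennreal_power)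
  show ?thesis
    unfolding eP[symmetric]
  proof (rule emeasure_periodic_ge[OF B_ext_borel P outer_borel[of "axis i 1"] periodic_B_ext])
    fix X :: "real ^ 'm ^ 'n"
    let ?S = "{s \<in> P. X + outer (axis i 1) s \<in> B_ext q \<delta>}"
    let ?G = "coprime_residues h q :: (int ^ 'm) set"
    define c where "c j = (real_vec q v* X) $ j" for j
    have shift: "(real_vec q v* (X + outer (axis i 1) s)) $ j = h * s $ j + c j" for s j
      by (simp add: mult_outer inner_axis real_vec_def qi c_def)
    \<comment> \<open>The multiple of \<open>h\<close> is chosen to put the centre of the interval
      for \<open>s $ j\<close> into [1/2, 3/2). Its radius \<open>\<delta> / h\<close> is below 1/2,
      so it stays inside the window.\<close>
    define t :: "int ^ 'm \<Rightarrow> 'm \<Rightarrow> int" where "t p j = \<lfloor>(- c j - p $ j) / h - 1/2\<rfloor>" for p j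
    define l :: "int ^ 'm \<Rightarrow> int ^ 'm" where "l p = (\<chi> j. p $ j + int h * t p j)" for p
    have l: "h / 2 \<le> - c j - l p $ j" "- c j - l p $ j < 3 * h / 2" for p j
    proof -
      have "t p j \<le> (- c j - p $ j) / h - 1/2" "(- c j - p $ j) / h - 1/2 < t p j + 1"
        unfolding t_def by linarith+
      then show "h / 2 \<le> - c j - l p $ j" "- c j - l p $ j < 3 * h / 2"
        using h by (simp_all add: l_def field_simps)
    qed
    define I where "I p j = {s. \<bar>real h * s + (c j + l p $ j)\<bar> < \<delta>}" for p j
    have I [measurable]: "I p j \<in> sets borel" for p j unfolding I_def by measurable
    define E where "E p = {s :: real ^ 'm. \<forall>j. s $ j \<in> I p j}" for p
    have E: "E p \<in> sets borel" for p unfolding E_def by (rule vec_prod_borel) measurable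
    have eE: "emeasure lborel (E p) = ennreal ((2 * \<delta> / h) ^ CARD('m))" for p
    proof -
      have "emeasure lborel (I p j) = ennreal (2 * \<delta> / h)" for j
        unfolding I_def using h d by (subst emeasure_affine_less) auto
      then show ?thesis
        unfolding E_def using d by (subst emeasure_lborel_vec_prod) (auto simp: ennreal_power)
    qed
    have disj: "disjoint_family_on E ?G"
      unfolding disjoint_family_on_def
    proof (intro ballI impI, rule ccontr)
      fix p r assume pr: "p \<in> ?G" "r \<in> ?G" "p \<noteq> r" "E p \<inter> E r \<noteq> {}"
      then obtain s where s: "s \<in> E p" "s \<in> E r" by blast
      have "p $ j = r $ j" for j
      proof -
        have "\<bar>real h * s $ j + (c j + l p $ j)\<bar> < \<delta>" "\<bar>real h * s $ j + (c j + l r $ j)\<bar> < \<delta>"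
          using s by (auto simp: E_def I_def)
        then have "\<bar>real_of_int (l p $ j) - l r $ j\<bar> < 1" using d by linarith
        then have "l p $ j = l r $ j" by linarith
        then have "p $ j - r $ j = int h * (t r j - t p j)" by (simp add: l_def right_diff_distrib)
        \<comment> \<open>Subtracting 1 moves \<open>{1..h}\<close> to \<open>{0..h-1}\<close>,
          where residues modulo \<open>h\<close> determine the number.\<close>
        then have "int h dvd (p $ j - 1) - (r $ j - 1)" by simp
        then have "(p $ j - 1) mod int h = (r $ j - 1) mod int h"
          unfolding mod_eq_dvd_iff .
        moreover have "p $ j \<in> {1..int h}" "r $ j \<in> {1..int h}"
          using pr(1,2) by (auto simp: coprime_residues_def)
        ultimately show ?thesis by simp
      qed
      then show False using pr(3) by (simp add: vec_eq_iff)
    qed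
    have "\<Union>(E ` ?G) \<subseteq> ?S"
    proof safe
      fix p s assume p: "p \<in> ?G" and s: "s \<in> E p"
      have s': "\<bar>real h * s $ j + (c j + l p $ j)\<bar> < \<delta>" for j
        using s by (auto simp: E_def I_def)
      have "s $ j \<in> {0..2}" for j
      proof -
        have "real h \<ge> 1" using h by simp
        have "real h * 0 < real h * s $ j" "real h * s $ j < real h * 2"
          using s'[of j] l[of j p] d \<open>real h \<ge> 1\<close> by linarith+
        then show ?thesis using h by (auto simp: zero_less_mult_iff)
      qed
      then show "s \<in> P" by (simp add: P_def)
      have "joint_gcd (l p) q = 1"
      proof -
        have "(\<forall>j. d dvd l p $ j) \<and> (\<forall>k. d dvd q $ k) \<longrightarrow> (\<forall>j. d dvd p $ j)" for d
        proof (intro impI allI, elim conjE)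
          fix j assume d: "\<forall>j. d dvd l p $ j" "\<forall>k. d dvd q $ k"
          have "d dvd int h" using d(2) qi by metis
          moreover have "d dvd p $ j + int h * t p j" using d(1) by (simp add: l_def)
          ultimately show "d dvd p $ j" by (simp add: dvd_add_left_iff)
        qed
        moreover have "joint_gcd p q = 1" using p by (simp add: coprime_residues_def)
        ultimately show ?thesis unfolding joint_gcd_eq_1_iff by blast
      qed
      then show "X + outer (axis i 1) s \<in> B_ext q \<delta>"
        unfolding B_ext_def mem_Collect_eq shift using s' by (intro exI[of _ "l p"]) (simp add: add.assoc)
    qed
    have meas: "?S \<in> sets borel" using P by measurable
    have "ennreal ((2 * \<delta> / h) ^ CARD('m) * card ?G) = (\<Sum>p\<in>?G. emeasure lborel (E p))"
      using d by (simp add: eE ennreal_mult' ennreal_of_nat_eq_real_of_nat mult.commute)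
    also have "\<dots> = emeasure lborel (\<Union>(E ` ?G))"
      using E disj by (intro sum_emeasure finite_coprime_residues) auto
    also have "\<dots> \<le> emeasure lborel ?S"
      using \<open>\<Union>(E ` ?G) \<subseteq> ?S\<close> meas by (intro emeasure_mono) auto
    finally show "ennreal ((2 * \<delta> / h) ^ CARD('m) * card ?G) \<le> emeasure lborel ?S" .
  qed
qed

text \<open>Part of one face of the sup-norm sphere of radius \<open>h\<close>: it still has
  \<open>h ^ (n - 1)\<close> points, and its fixed entry \<open>h\<close> is what
  \<open>emeasure_B_ge\<close> requires.\<close>

definition slice :: "'n \<Rightarrow> nat \<Rightarrow> (int ^ 'n) set" where
  "slice i h = {q. \<forall>k. q $ k \<in> (if k = i then {int h} else {1..int h})}"

lemma finite_slice: "finite (slice i h)"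
  unfolding slice_def by (rule finite_vec_prod) simp

lemma int_supnorm_eq_iff:
  "int_supnorm q = h \<longleftrightarrow> (\<exists>k. \<bar>q $ k\<bar> = int h) \<and> (\<forall>k. \<bar>q $ k\<bar> \<le> int h)"
proof -
  have "int_supnorm q = h \<longleftrightarrow> (\<exists>k. nat \<bar>q $ k\<bar> = h) \<and> (\<forall>k. nat \<bar>q $ k\<bar> \<le> h)"
    unfolding int_supnorm_def by (subst Max_eq_iff) auto
  also have "\<dots> \<longleftrightarrow> (\<exists>k. \<bar>q $ k\<bar> = int h) \<and> (\<forall>k. \<bar>q $ k\<bar> \<le> int h)"
    by (metis abs_ge_zero int_nat_eq nat_int nat_le_iff)
  finally show ?thesis .
qed

lemma slice_supnorm: "int_supnorm q = h" if "q \<in> slice i h"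
proof -
  have "q $ k \<in> (if k = i then {int h} else {1..int h})" for k using that by (simp add: slice_def)
  then have "q $ i = int h" "0 \<le> q $ k \<and> q $ k \<le> int h" for k
    by (metis singletonD, metis atLeastAtMost_iff empty_iff insert_iff of_nat_0_le_iff order_refl zero_le_one order_trans)
  then show ?thesis unfolding int_supnorm_eq_iff by (metis abs_of_nonneg)
qed

section \<open>Sieving out common divisors\<close>

lemma prod_if_eq: "(\<Prod>k\<in>(UNIV :: 'n::finite set). if k = i then a else b) = a * (b :: 'a :: comm_semiring_1) ^ (CARD('n) - 1)"
  by (subst prod.remove[of _ i]) (auto simp: card_Diff_singleton intro!: prod.cong)

text \<open>Telescoping via \<open>1 / (h * (h + 1))\<close>; the induction needs the sharper bound
  \<open>3/4 - 1 / h\<close>, an equality at \<open>h = 2\<close>.\<close>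

lemma sum_inverse_squares_le: "(\<Sum>l=2..h. 1 / real l ^ 2) \<le> 3/4" for h :: nat
proof -
  have "(\<Sum>l=2..h. 1 / real l ^ 2) \<le> 3/4 - 1 / h" if "h \<ge> 2"
    using that
  proof (induction h rule: dec_induct)
    case (step h)
    have "1 / real (Suc h) ^ 2 \<le> 1 / (real h * real (Suc h))"
      using step.hyps by (intro divide_left_mono) (auto simp: power2_eq_square)
    also have "\<dots> = 1 / real h - 1 / real (Suc h)"
      using step.hyps by (simp add: field_simps)
    finally show ?case using step by simp
  qed (simp add: numeral_2_eq_2)
  moreover have "(0::real) \<le> 1 / h" by simp
  ultimately show ?thesis
    by (cases "h \<ge> 2") (linarith, simp)
qed

lemma card_multiples_le:
  fixes l h :: nat assumes "l \<ge> 1"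
  shows "real (card {x \<in> {1..int h}. int l dvd x}) \<le> h / l"
proof -
  have "{x \<in> {1..int h}. int l dvd x} \<subseteq> (\<lambda>k. int l * k) ` {1..int (h div l)}"
  proof
    fix x assume x: "x \<in> {x \<in> {1..int h}. int l dvd x}"
    then obtain k where k: "x = int l * k" by auto
    have "0 < int l * k" using x k by simp
    then have "1 \<le> k" using assms by (simp add: zero_less_mult_iff)
    moreover have "k \<le> int h div int l"
      using zdiv_mono1[of "int l * k" "int h" "int l"] x k assms by simp
    ultimately show "x \<in> (\<lambda>k. int l * k) ` {1..int (h div l)}" using k by (auto simp: zdiv_int)
  qed
  then have "card {x \<in> {1..int h}. int l dvd x} \<le> h div l"
    using surj_card_le[of "{1..int (h div l)}"] by simp
  then have "real (card {x \<in> {1..int h}. int l dvd x}) \<le> real (h div l)" by simp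
  also have "\<dots> \<le> h / l" by (rule of_nat_div_le_of_nat)
  finally show ?thesis .
qed

text \<open>A union bound: a pair that is not coprime has a common divisor \<open>l\<close> between
  2 and \<open>h\<close>, and at most a fraction \<open>1 / l ^ 2\<close> of all pairs is divisible
  by \<open>l\<close>. At least a quarter survives.\<close>

lemma sum_card_coprime_residues:
  assumes nm: "CARD('n) * CARD('m::finite) > 1" and h: "h \<ge> 1"
  shows "(\<Sum>q\<in>slice (i :: 'n::finite) h. real (card (coprime_residues h q :: (int ^ 'm) set)))
    \<ge> real h ^ (CARD('n) - 1) * real h ^ CARD('m) / 4"
proof -
  let ?e = "CARD('n) - 1 + CARD('m)"
  define V :: "(int ^ 'm) set" where "V = {p. \<forall>j. p $ j \<in> {1..int h}}"
  define M where "M l = {x \<in> {1..int h}. int l dvd x}" for l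
  \<comment> \<open>Entry \<open>i\<close> stays \<open>h\<close> even if \<open>l\<close> does not
    divide \<open>h\<close>; this only enlarges the covering sets and keeps their count
    uniform.\<close>
  define bad where "bad l = {q :: int ^ 'n. \<forall>k. q $ k \<in> (if k = i then {int h} else M l)}
    \<times> {p :: int ^ 'm. \<forall>j. p $ j \<in> M l}" for l
  \<comment> \<open>Here \<open>nm > 1\<close> enters: for \<open>n = m = 1\<close> the exponent
    would be 1 and the harmonic sum would appear.\<close>
  have e: "?e \<ge> 2"
  proof -
    have "CARD('n) \<ge> 1" "CARD('m) \<ge> 1" by (simp_all add: Suc_leI)
    moreover have "CARD('n) \<noteq> 1 \<or> CARD('m) \<noteq> 1" using nm by auto
    ultimately show ?thesis by linarith
  qed
  have V: "finite V" unfolding V_def by (rule finite_vec_prod) simp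
  have sub: "coprime_residues h q \<subseteq> V" for q :: "int ^ 'n" by (auto simp: coprime_residues_def V_def)
  have M: "finite (M l)" for l unfolding M_def by (rule finite_subset[of _ "{1..int h}"]) auto
  have bad: "finite (bad l)" for l
    unfolding bad_def using M by (intro finite_cartesian_product finite_vec_prod) auto
  have card_bad: "real (card (bad l)) \<le> real h ^ ?e * (1 / real l ^ 2)" if "l \<in> {2..h}" for l
  proof -
    have l: "1 \<le> l" "l \<le> h" using that by auto
    have "card (bad l) = card (M l) ^ (CARD('n) - 1) * card (M l) ^ CARD('m)"
      unfolding bad_def card_cartesian_product card_vec_prod
      by (simp add: prod_if_eq if_distrib[of card] cong: if_cong)
    then have "real (card (bad l)) = real (card (M l)) ^ ?e"
      by (simp only: of_nat_mult of_nat_power power_add)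
    also have "\<dots> \<le> (real h / real l) ^ ?e"
      unfolding M_def by (intro power_mono card_multiples_le l) simp
    also have "\<dots> = real h ^ ?e * (1 / real l) ^ ?e"
      by (simp add: power_divide)
    also have "\<dots> \<le> real h ^ ?e * (1 / real l) ^ 2"
      using l e by (intro mult_left_mono power_decreasing) auto
    finally show ?thesis by (simp add: power_divide)
  qed
  have cover: "slice i h \<times> V \<subseteq> Sigma (slice i h) (coprime_residues h) \<union> (\<Union>l\<in>{2..h}. bad l)"
  proof safe
    fix q p assume qp: "q \<in> slice i h" "p \<in> V" "(q, p) \<notin> (\<Union>l\<in>{2..h}. bad l)"
    show "p \<in> coprime_residues h q"
    proof (rule ccontr)
      assume "p \<notin> coprime_residues h q"
      then have "joint_gcd p q \<noteq> 1" using qp(2) by (simp add: coprime_residues_def V_def)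
      then obtain d where d: "\<And>j. d dvd p $ j" "\<And>k. d dvd q $ k" "\<not> is_unit d"
        unfolding joint_gcd_eq_1_iff by blast
      have q: "q $ k \<in> (if k = i then {int h} else {1..int h})" for k using qp(1) by (simp add: slice_def)
      have "d dvd int h" using d(2)[of i] q[of i] by simp
      define l where "l = nat \<bar>d\<bar>"
      have l: "int l dvd x \<longleftrightarrow> d dvd x" for x by (simp add: l_def)
      have "l \<noteq> 0" using \<open>d dvd int h\<close> h by (auto simp: l_def)
      moreover have "l \<noteq> 1" using d(3) by (auto simp: l_def)
      moreover have "l \<le> h" using \<open>d dvd int h\<close> h l by (metis dvd_imp_le int_dvd_int_iff less_eq_Suc_le One_nat_def)
      ultimately have "l \<in> {2..h}" by simp
      moreover have "(q, p) \<in> bad l"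
      proof -
        have "q $ i = int h" "k \<noteq> i \<Longrightarrow> q $ k \<in> {1..int h}" for k
          using q[of i] q[of k] by simp_all
        then show ?thesis
          using d(1,2) qp(2) unfolding bad_def M_def V_def by (auto simp: l)
      qed
      ultimately show False using qp(3) by blast
    qed
  qed
  have "real (card (slice i h \<times> V)) \<le> real (card (Sigma (slice i h) (coprime_residues h :: _ \<Rightarrow> (int ^ 'm) set)))
      + real (card (\<Union>l\<in>{2..h}. bad l))"
    unfolding of_nat_add[symmetric] of_nat_le_iff
    using bad
    by (intro order_trans[OF card_mono[OF _ cover] card_Un_le] finite_UnI finite_SigmaI
        finite_slice finite_coprime_residues) auto
  also have "card (Sigma (slice i h) (coprime_residues h :: _ \<Rightarrow> (int ^ 'm) set))
      = (\<Sum>q\<in>slice i h. card (coprime_residues h q :: (int ^ 'm) set))"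
    by (intro card_SigmaI finite_slice ballI finite_coprime_residues)
  also have "real (card (\<Union>l\<in>{2..h}. bad l)) \<le> (\<Sum>l\<in>{2..h}. real (card (bad l)))"
    by (metis card_UN_le finite_atLeastAtMost of_nat_le_iff of_nat_sum)
  also have "\<dots> \<le> (\<Sum>l\<in>{2..h}. real h ^ ?e * (1 / real l ^ 2))"
    by (intro sum_mono card_bad)
  also have "\<dots> = real h ^ ?e * (\<Sum>l=2..h. 1 / real l ^ 2)"
    by (simp only: sum_distrib_left)
  also have "\<dots> \<le> real h ^ ?e * (3/4)"
    by (intro mult_left_mono sum_inverse_squares_le) auto
  finally have "real (card (slice i h \<times> V))
      \<le> (\<Sum>q\<in>slice i h. real (card (coprime_residues h q :: (int ^ 'm) set))) + real h ^ ?e * (3/4)"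
    by simp
  moreover have "card (slice i h \<times> V) = h ^ ?e"
    unfolding slice_def V_def card_cartesian_product card_vec_prod
    by (simp add: prod_if_eq if_distrib[of card] cong: if_cong flip: power_add)
  ultimately have "real h ^ ?e / 4 \<le> (\<Sum>q\<in>slice i h. real (card (coprime_residues h q :: (int ^ 'm) set)))"
    by simp
  then show ?thesis by (simp only: power_add)
qed

text \<open>The cubes have volume of order \<open>(\<delta> / h) ^ m\<close>, and the slice has on
  average at least \<open>h ^ m / 4\<close> coprime classes, so the powers \<open>h ^ m\<close>
  cancel.\<close>

lemma sum_measure_slice_ge:
  assumes nm: "CARD('n) * CARD('m::finite) > 1" and h: "h \<ge> 1" and d: "0 < \<delta>" "\<delta> < 1/2"
  shows "(\<Sum>q\<in>slice (i :: 'n::finite) h. measure lebesgue (B' q \<delta> :: (real ^ 'm ^ 'n) set))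
    \<ge> real h ^ (CARD('n) - 1) * \<delta> ^ CARD('m) / 4"
proof -
  have "(\<delta> / h) ^ CARD('m) * card (coprime_residues h q :: (int ^ 'm) set)
      \<le> measure lebesgue (B' q \<delta> :: (real ^ 'm ^ 'n) set)" if q: "q \<in> slice i h" for q
  proof -
    have qi: "q $ i = int h" using q by (auto simp: slice_def dest: spec[of _ i])
    have "emeasure lborel (B_ext q \<delta> \<inter> cbox 0 (One :: real ^ 'm ^ 'n)) = emeasure lebesgue (B' q \<delta> :: (real ^ 'm ^ 'n) set)"
      unfolding B'_eq by simp
    also have "\<dots> = ennreal (measure lebesgue (B' q \<delta> :: (real ^ 'm ^ 'n) set))"
      using B'_lmeasurable by (rule emeasure_eq_measure2)
    finally have "ennreal ((2 * \<delta> / h) ^ CARD('m) * card (coprime_residues h q :: (int ^ 'm) set))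
      \<le> ennreal (2 ^ CARD('m) * measure lebesgue (B' q \<delta> :: (real ^ 'm ^ 'n) set))"
      using emeasure_B_ge[OF qi h d, where 'm = 'm] by (simp add: ennreal_mult)
    \<comment> \<open>The volume of the window of side 2 cancels the factor 2 in the interval
      lengths.\<close>
    then have "2 ^ CARD('m) * ((\<delta> / h) ^ CARD('m) * card (coprime_residues h q :: (int ^ 'm) set))
      \<le> 2 ^ CARD('m) * measure lebesgue (B' q \<delta> :: (real ^ 'm ^ 'n) set)"
      by (simp add: ennreal_le_iff power_mult_distrib power_divide)
    then show ?thesis by simp
  qed
  then have "(\<Sum>q\<in>slice i h. measure lebesgue (B' q \<delta> :: (real ^ 'm ^ 'n) set))
      \<ge> (\<Sum>q\<in>slice i h. (\<delta> / h) ^ CARD('m) * card (coprime_residues h q :: (int ^ 'm) set))"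
    by (rule sum_mono)
  moreover have "(\<Sum>q\<in>slice i h. (\<delta> / h) ^ CARD('m) * card (coprime_residues h q :: (int ^ 'm) set))
      \<ge> (\<delta> / h) ^ CARD('m) * (real h ^ (CARD('n) - 1) * real h ^ CARD('m) / 4)"
    unfolding sum_distrib_left[symmetric]
    using d by (intro mult_left_mono sum_card_coprime_residues nm h) auto
  moreover have "(\<delta> / h) ^ CARD('m) * (real h ^ (CARD('n) - 1) * real h ^ CARD('m) / 4)
      = real h ^ (CARD('n) - 1) * \<delta> ^ CARD('m) / 4"
    using h by (simp add: power_divide)
  ultimately show ?thesis by linarith
qed

text \<open>The sphere is covered by \<open>2 * n\<close> faces, each with
  \<open>(2 * h + 1) ^ (n - 1)\<close> points, and \<open>2 * h + 1 \<le> 3 * h\<close>.\<close>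

lemma card_supnorm_eq_le:
  assumes h: "h \<ge> 1"
  shows "real (card {q :: int ^ 'n. int_supnorm q = h})
    \<le> 2 * CARD('n) * 3 ^ (CARD('n) - 1) * real h ^ (CARD('n) - 1)"
proof -
  define T where "T i = {q :: int ^ 'n. \<forall>k. q $ k \<in> (if k = i then {int h, - int h} else {- int h..int h})}" for i
  have T: "finite (T i)" for i unfolding T_def by (rule finite_vec_prod) simp
  have cT: "real (card (T i)) \<le> 2 * (3 ^ (CARD('n) - 1) * real h ^ (CARD('n) - 1))" for i
  proof -
    have "card (T i) = 2 * (2 * h + 1) ^ (CARD('n) - 1)"
      unfolding T_def card_vec_prod using h
      by (simp add: prod_if_eq if_distrib[of card] nat_add_distrib nat_mult_distrib cong: if_cong)
    also have "\<dots> \<le> 2 * (3 * h) ^ (CARD('n) - 1)"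
      using h by (intro mult_left_mono power_mono) auto
    finally have "real (card (T i)) \<le> real (2 * (3 * h) ^ (CARD('n) - 1))" by (rule of_nat_mono)
    then show ?thesis by (simp add: power_mult_distrib)
  qed
  have "{q :: int ^ 'n. int_supnorm q = h} \<subseteq> (\<Union>i. T i)"
  proof
    fix q :: "int ^ 'n" assume "q \<in> {q. int_supnorm q = h}"
    then obtain i where i: "\<bar>q $ i\<bar> = int h" and q: "\<And>k. \<bar>q $ k\<bar> \<le> int h"
      by (auto simp: int_supnorm_eq_iff)
    have "q $ i = int h \<or> q $ i = - int h" using i by linarith
    moreover have "- int h \<le> q $ k \<and> q $ k \<le> int h" for k using q[of k] by linarith
    ultimately have "q \<in> T i" by (simp add: T_def)
    then show "q \<in> (\<Union>i. T i)" by blast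
  qed
  then have "card {q :: int ^ 'n. int_supnorm q = h} \<le> (\<Sum>i\<in>UNIV. card (T i))"
    using T by (intro order_trans[OF card_mono card_UN_le]) auto
  then have "real (card {q :: int ^ 'n. int_supnorm q = h}) \<le> (\<Sum>i\<in>UNIV. real (card (T i)))"
    by (metis of_nat_le_iff of_nat_sum)
  also have "\<dots> \<le> (\<Sum>i\<in>(UNIV :: 'n set). 2 * (3 ^ (CARD('n) - 1) * real h ^ (CARD('n) - 1)))"
    by (intro sum_mono cT)
  finally show ?thesis by (simp add: algebra_simps)
qed

section \<open>Quasi-independence on average\<close>

text \<open>Either some 2 by 2 minor of the two vectors is nonzero, or they are parallel; the
  constant 48 covers both cases.\<close>

lemma measure_B'_Int_le:
  fixes q\<^sub>1 q\<^sub>2 :: "int ^ 'n"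
  assumes nz: "q\<^sub>1 \<noteq> 0" "q\<^sub>2 \<noteq> 0" and ne: "q\<^sub>1 \<noteq> q\<^sub>2" "q\<^sub>1 \<noteq> - q\<^sub>2"
    and d: "0 < \<delta>\<^sub>1" "\<delta>\<^sub>1 < 1/2" "0 < \<delta>\<^sub>2" "\<delta>\<^sub>2 < 1/2"
  shows "measure lebesgue (B' q\<^sub>1 \<delta>\<^sub>1 \<inter> B' q\<^sub>2 \<delta>\<^sub>2 :: (real ^ 'm ^ 'n) set)
    \<le> 48 ^ CARD('m) * (\<delta>\<^sub>1 ^ CARD('m) * \<delta>\<^sub>2 ^ CARD('m))"
proof -
  have "emeasure lborel (B_ext q\<^sub>1 \<delta>\<^sub>1 \<inter> B_ext q\<^sub>2 \<delta>\<^sub>2 \<inter> cbox 0 (One :: real ^ 'm ^ 'n))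
    \<le> ennreal ((48 * \<delta>\<^sub>1 * \<delta>\<^sub>2) ^ CARD('m))"
  proof (cases "\<exists>i k. q\<^sub>1 $ i * q\<^sub>2 $ k \<noteq> q\<^sub>1 $ k * q\<^sub>2 $ i")
    case True
    then obtain i k where "q\<^sub>1 $ i * q\<^sub>2 $ k \<noteq> q\<^sub>1 $ k * q\<^sub>2 $ i" by blast
    note emeasure_B_independent[OF this d, where 'm = 'm]
    also have "ennreal ((16 * \<delta>\<^sub>1 * \<delta>\<^sub>2) ^ CARD('m)) \<le> ennreal ((48 * \<delta>\<^sub>1 * \<delta>\<^sub>2) ^ CARD('m))"
      using d by (intro ennreal_leI power_mono mult_right_mono) auto
    finally show ?thesis .
  next
    case False
    then have par: "q\<^sub>1 $ i * q\<^sub>2 $ k = q\<^sub>1 $ k * q\<^sub>2 $ i" for i k by blast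
    obtain i where i: "q\<^sub>1 $ i \<noteq> 0" using nz(1) by (auto simp: vec_eq_iff)
    obtain k where k: "q\<^sub>2 $ k \<noteq> 0" using nz(2) by (auto simp: vec_eq_iff)
    \<comment> \<open>The parallel case needs one index at which both vectors are nonzero; the
      vanishing minor at \<open>i\<close>, \<open>k\<close> provides it.\<close>
    have "q\<^sub>2 $ i \<noteq> 0" using par[of i k] i k by auto
    then show ?thesis
      using par by (intro emeasure_B_parallel[of q\<^sub>1 q\<^sub>2 i] i ne d) (metis mult.commute)
  qed
  also have "B_ext q\<^sub>1 \<delta>\<^sub>1 \<inter> B_ext q\<^sub>2 \<delta>\<^sub>2 \<inter> cbox 0 (One :: real ^ 'm ^ 'n) = B' q\<^sub>1 \<delta>\<^sub>1 \<inter> B' q\<^sub>2 \<delta>\<^sub>2"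
    by (auto simp: B'_eq)
  finally have "emeasure lborel (B' q\<^sub>1 \<delta>\<^sub>1 \<inter> B' q\<^sub>2 \<delta>\<^sub>2 :: (real ^ 'm ^ 'n) set)
    \<le> ennreal ((48 * \<delta>\<^sub>1 * \<delta>\<^sub>2) ^ CARD('m))" .
  moreover have "emeasure lebesgue (B' q\<^sub>1 \<delta>\<^sub>1 \<inter> B' q\<^sub>2 \<delta>\<^sub>2 :: (real ^ 'm ^ 'n) set)
      = emeasure lborel (B' q\<^sub>1 \<delta>\<^sub>1 \<inter> B' q\<^sub>2 \<delta>\<^sub>2 :: (real ^ 'm ^ 'n) set)"
    by (simp add: B'_eq)
  ultimately have "measure lebesgue (B' q\<^sub>1 \<delta>\<^sub>1 \<inter> B' q\<^sub>2 \<delta>\<^sub>2 :: (real ^ 'm ^ 'n) set) \<le> (48 * \<delta>\<^sub>1 * \<delta>\<^sub>2) ^ CARD('m)"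
    unfolding measure_def using d by (intro enn2real_leI) auto
  then show ?thesis by (simp add: power_mult_distrib mult.assoc)
qed

section \<open>Sums over balls compared with the divergent series\<close>

lemma nonzero_ball_eq: "nonzero_ball N = (\<Union>h\<in>{1..N}. {q :: int ^ 'n. int_supnorm q = h})"
proof -
  have "q \<noteq> 0 \<longleftrightarrow> 1 \<le> int_supnorm q" for q :: "int ^ 'n"
  proof -
    have "int_supnorm q = 0 \<longleftrightarrow> q = 0"
      unfolding int_supnorm_eq_iff by (auto simp: vec_eq_iff)
    then show ?thesis by linarith
  qed
  then have "q \<in> nonzero_ball N \<longleftrightarrow> 1 \<le> int_supnorm q \<and> int_supnorm q \<le> N" for q :: "int ^ 'n"
    unfolding nonzero_ball_def by blast
  then show ?thesis
    by (intro set_eqI) (simp only: UN_iff Bex_def mem_Collect_eq atLeastAtMost_iff, blast)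
qed

lemma finite_supnorm_eq: "finite {q :: int ^ 'n. int_supnorm q = h}" if "h \<ge> 1"
  by (rule finite_subset[OF _ finite_nonzero_ball[of h]]) (use that in \<open>auto simp: nonzero_ball_eq\<close>)

text \<open>Summation over spheres. With \<open>f\<close> the \<open>m\<close>-th power of
  \<open>\<psi>\<close> it bounds the sum of expected sizes by the partial sums of the
  series.\<close>

lemma sum_nonzero_ball_supnorm_le:
  assumes "\<And>h. h \<ge> 1 \<Longrightarrow> f h \<ge> (0::real)"
  shows "(\<Sum>q\<in>(nonzero_ball N :: (int ^ 'n) set). f (int_supnorm q))
    \<le> 2 * CARD('n) * 3 ^ (CARD('n) - 1) * (\<Sum>h=1..N. real h ^ (CARD('n) - 1) * f h)"
proof -
  have "(\<Sum>q\<in>(nonzero_ball N :: (int ^ 'n) set). f (int_supnorm q))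
      = (\<Sum>h=1..N. \<Sum>q\<in>{q :: int ^ 'n. int_supnorm q = h}. f (int_supnorm q))"
    unfolding nonzero_ball_eq by (intro sum.UNION_disjoint) (auto simp: finite_supnorm_eq)
  also have "\<dots> = (\<Sum>h=1..N. real (card {q :: int ^ 'n. int_supnorm q = h}) * f h)"
    by (intro sum.cong) auto
  also have "\<dots> \<le> (\<Sum>h=1..N. 2 * CARD('n) * 3 ^ (CARD('n) - 1) * real h ^ (CARD('n) - 1) * f h)"
    using assms by (intro sum_mono mult_right_mono card_supnorm_eq_le) auto
  also have "\<dots> = 2 * CARD('n) * 3 ^ (CARD('n) - 1) * (\<Sum>h=1..N. real h ^ (CARD('n) - 1) * f h)"
    by (simp add: sum_distrib_left mult.assoc)
  finally show ?thesis .
qed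

text \<open>One slice per norm, at an arbitrary coordinate \<open>i\<close>, suffices; slices of
  different norms are disjoint parts of the ball.\<close>

lemma sum_measure_B'_at_ge:
  assumes nm: "CARD('n::finite) * CARD('m::finite) > 1"
    and \<psi>: "\<And>h. h \<ge> 1 \<Longrightarrow> \<psi> h > 0" "\<And>h. h \<ge> 1 \<Longrightarrow> \<psi> h < 1 / 2"
  shows "(\<Sum>h=1..N. real h ^ (CARD('n) - 1) * \<psi> h ^ CARD('m)) / 4
    \<le> (\<Sum>q\<in>nonzero_ball N. measure lebesgue (B'_at \<psi> q :: (real ^ 'm ^ 'n) set))"
proof -
  let ?\<mu> = "\<lambda>q. measure lebesgue (B'_at \<psi> q :: (real ^ 'm ^ 'n) set)"
  fix i :: 'n
  have "(\<Sum>h=1..N. real h ^ (CARD('n) - 1) * \<psi> h ^ CARD('m)) / 4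
      \<le> (\<Sum>h=1..N. \<Sum>q\<in>slice i h. measure lebesgue (B' q (\<psi> h) :: (real ^ 'm ^ 'n) set))"
    unfolding sum_divide_distrib
    using sum_measure_slice_ge[OF nm, of _ "\<psi> _" i] \<psi> by (intro sum_mono) simp
  also have "\<dots> = (\<Sum>h=1..N. \<Sum>q\<in>slice i h. ?\<mu> q)"
    by (intro sum.cong) (simp_all add: B'_at_def slice_supnorm)
  also have "\<dots> = (\<Sum>q\<in>(\<Union>h\<in>{1..N}. slice i h). ?\<mu> q)"
    by (intro sum.UNION_disjoint[symmetric]) (auto simp: finite_slice dest!: slice_supnorm)
  also have "\<dots> \<le> (\<Sum>q\<in>nonzero_ball N. ?\<mu> q)"
    by (intro sum_mono2 finite_nonzero_ball) (auto simp: nonzero_ball_eq dest: slice_supnorm)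
  finally show ?thesis .
qed

text \<open>Turns divergence in \<open>ennreal\<close> into real partial sums exceeding every bound,
  which persists because the terms are nonnegative.\<close>

lemma eventually_partial_sums_ge:
  fixes f :: "nat \<Rightarrow> real"
  assumes f: "\<And>h. h \<ge> 1 \<Longrightarrow> f h \<ge> 0" and div: "(\<Sum>k. ennreal (f (Suc k))) = \<infinity>"
  shows "\<forall>\<^sub>F N in sequentially. B \<le> (\<Sum>h=1..N. f h)"
proof -
  have "ennreal B < (\<Sum>k. ennreal (f (Suc k)))"
    unfolding div by simp
  then obtain n where "ennreal B < (\<Sum>k<n. ennreal (f (Suc k)))"
    unfolding suminf_eq_SUP less_SUP_iff by blast
  also have "\<dots> = ennreal (\<Sum>h=1..n. f h)"
    using f by (simp add: sum_ennreal sum.atLeast1_atMost_eq)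
  finally have B: "B \<le> (\<Sum>h=1..n. f h)"
    by (metis ennreal_leI linorder_not_less nle_le)
  have "B \<le> (\<Sum>h=1..N. f h)" if "n \<le> N" for N
  proof -
    have "(\<Sum>h=1..n. f h) \<le> (\<Sum>h=1..N. f h)"
      using f that by (intro sum_mono2) auto
    then show ?thesis using B by linarith
  qed
  then show ?thesis unfolding eventually_sequentially by blast
qed

theorem theorem3:
  fixes \<psi> :: "nat \<Rightarrow> real"
  assumes nm: "CARD('n::finite) * CARD('m::finite) > 1"
    and pos: "\<And>h. h \<ge> 1 \<Longrightarrow> \<psi> h > 0"
    and lt: "\<And>h. h \<ge> 1 \<Longrightarrow> \<psi> h < 1 / 2"
    and div: "(\<Sum>k. ennreal (real (Suc k) ^ (CARD('n) - 1) * \<psi> (Suc k) ^ CARD('m))) = \<infinity>"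
  shows "(\<Sum>\<^sub>\<infinity>q\<in>UNIV - {0}. emeasure lebesgue (B'_at \<psi> q :: (real ^ 'm ^ 'n) set)) = \<infinity>
    \<and> (\<exists>C>1. \<forall>\<^sub>F N in sequentially.
        (\<Sum>q\<^sub>1\<in>nonzero_ball N. \<Sum>q\<^sub>2\<in>nonzero_ball N.
           measure lebesgue ((B'_at \<psi> q\<^sub>1 :: (real ^ 'm ^ 'n) set) \<inter> B'_at \<psi> q\<^sub>2))
        \<le> C * (\<Sum>q\<^sub>1\<in>nonzero_ball N. measure lebesgue (B'_at \<psi> q\<^sub>1 :: (real ^ 'm ^ 'n) set))\<^sup>2)"
proof
  let ?n = "CARD('n)" and ?m = "CARD('m)"
  let ?B = "\<lambda>q. B'_at \<psi> q :: (real ^ 'm ^ 'n) set"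
  let ?Q = "\<lambda>N. nonzero_ball N :: (int ^ 'n) set"
  define a where "a h = real h ^ (?n - 1) * \<psi> h ^ ?m" for h
  \<comment> \<open>\<open>S\<close> sums the true measures and \<open>W\<close> the sizes in the
    overlap bound. Both are compared with partial sums of \<open>a\<close>, which gives
    \<open>W N \<le> 4 * K * S N\<close>.\<close>
  define S where "S N = (\<Sum>q\<in>?Q N. measure lebesgue (?B q))" for N
  define W where "W N = (\<Sum>q\<in>?Q N. \<psi> (int_supnorm q) ^ ?m)" for N
  define K :: real where "K = 2 * ?n * 3 ^ (?n - 1)"
  have a: "a h \<ge> 0" if "h \<ge> 1" for h using pos[OF that] by (simp add: a_def)
  have K: "K > 0" by (simp add: K_def)
  have S_ge: "(\<Sum>h=1..N. a h) / 4 \<le> S N" for N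
    unfolding a_def S_def by (rule sum_measure_B'_at_ge[OF nm pos lt])
  have S_large: "\<forall>\<^sub>F N in sequentially. B \<le> S N" for B
  proof -
    have "\<forall>\<^sub>F N in sequentially. 4 * B \<le> (\<Sum>h=1..N. a h)"
      using a div[folded a_def] by (rule eventually_partial_sums_ge)
    then show ?thesis
    proof eventually_elim
      case (elim N)
      then show ?case using S_ge[of N] by linarith
    qed
  qed
  have W_le: "W N \<le> 4 * K * S N" for N
  proof -
    have "W N \<le> K * (\<Sum>h=1..N. a h)"
      unfolding W_def K_def a_def using pos
      by (intro sum_nonzero_ball_supnorm_le) (simp add: less_imp_le)
    also have "\<dots> \<le> K * (4 * S N)"
      using S_ge[of N] K by (intro mult_left_mono) auto
    finally show ?thesis by simp
  qed
  have supnorm: "int_supnorm q \<ge> 1" if "q \<in> ?Q N" for q N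
    using that by (auto simp: nonzero_ball_eq)
  have W_nonneg: "W N \<ge> 0" for N
    unfolding W_def using pos supnorm by (intro sum_nonneg zero_le_power) (simp add: less_imp_le)

  show "(\<Sum>\<^sub>\<infinity>q\<in>UNIV - {0}. emeasure lebesgue (?B q)) = \<infinity>"
  proof -
    have "ennreal B \<le> (\<Sum>\<^sub>\<infinity>q\<in>UNIV - {0}. emeasure lebesgue (?B q))" for B
    proof -
      obtain N where N: "B \<le> S N"
        using S_large[of B] unfolding eventually_sequentially by blast
      have "ennreal B \<le> ennreal (S N)" using N by (rule ennreal_leI)
      also have "\<dots> = (\<Sum>q\<in>?Q N. emeasure lebesgue (?B q))"
        unfolding S_def B'_at_def
        by (simp add: emeasure_eq_measure2[OF B'_lmeasurable] sum_ennreal)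
      also have "\<dots> \<le> (\<Sum>\<^sub>\<infinity>q\<in>UNIV - {0}. emeasure lebesgue (?B q))"
        \<comment> \<open>The infinite sum is the supremum over finite subsets, and the balls are
          among them.\<close>
        by (subst nonneg_infsum_complete, simp, rule SUP_upper)
          (use finite_nonzero_ball[of N, where 'n = 'n] in \<open>auto simp: nonzero_ball_def\<close>)
      finally show ?thesis .
    qed
    note large = this
    show ?thesis
    proof (rule ccontr)
      assume "(\<Sum>\<^sub>\<infinity>q\<in>UNIV - {0}. emeasure lebesgue (?B q)) \<noteq> \<infinity>"
      then obtain r where r: "(\<Sum>\<^sub>\<infinity>q\<in>UNIV - {0}. emeasure lebesgue (?B q)) = ennreal r" "r \<ge> 0"
        by (cases "(\<Sum>\<^sub>\<infinity>q\<in>UNIV - {0}. emeasure lebesgue (?B q))") auto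
      then show False using large[of "r + 1"] by simp
    qed
  qed

  show "\<exists>C>1. \<forall>\<^sub>F N in sequentially.
      (\<Sum>q\<^sub>1\<in>?Q N. \<Sum>q\<^sub>2\<in>?Q N. measure lebesgue (?B q\<^sub>1 \<inter> ?B q\<^sub>2))
      \<le> C * (\<Sum>q\<^sub>1\<in>?Q N. measure lebesgue (?B q\<^sub>1))\<^sup>2"
  proof (intro exI conjI)
    \<comment> \<open>The first summand of the constant accounts for pairs in general position or
      parallel, the 2 for \<open>q\<^sub>2 = q\<^sub>1\<close> and
      \<open>q\<^sub>2 = - q\<^sub>1\<close>; the 2 also makes it exceed 1.\<close>
    have "0 \<le> 48 ^ ?m * (4 * K)\<^sup>2" by simp
    then show "48 ^ ?m * (4 * K)\<^sup>2 + 2 > 1" by linarith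
    show "\<forall>\<^sub>F N in sequentially.
      (\<Sum>q\<^sub>1\<in>?Q N. \<Sum>q\<^sub>2\<in>?Q N. measure lebesgue (?B q\<^sub>1 \<inter> ?B q\<^sub>2))
      \<le> (48 ^ ?m * (4 * K)\<^sup>2 + 2) * (\<Sum>q\<^sub>1\<in>?Q N. measure lebesgue (?B q\<^sub>1))\<^sup>2"
      \<comment> \<open>\<open>S N \<ge> 1\<close> lets the linear term \<open>2 * S N\<close> be
        absorbed into the square.\<close>
      using S_large[of 1]
    proof eventually_elim
      case (elim N)
      let ?\<Psi> = "\<lambda>q. \<psi> (int_supnorm q) ^ ?m"
      let ?\<mu> = "\<lambda>q. measure lebesgue (?B q)"
      \<comment> \<open>The two exceptional cases are separate summands, so that for each
        \<open>q\<^sub>1\<close> they sum over \<open>q\<^sub>2\<close> to at most twice the measure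
        of the set at \<open>q\<^sub>1\<close>.\<close>
      have pair: "measure lebesgue (?B q\<^sub>1 \<inter> ?B q\<^sub>2)
          \<le> 48 ^ ?m * (?\<Psi> q\<^sub>1 * ?\<Psi> q\<^sub>2)
            + ((if q\<^sub>2 = q\<^sub>1 then ?\<mu> q\<^sub>1 else 0) + (if q\<^sub>2 = - q\<^sub>1 then ?\<mu> q\<^sub>1 else 0))"
        if q: "q\<^sub>1 \<in> ?Q N" "q\<^sub>2 \<in> ?Q N" for q\<^sub>1 q\<^sub>2
      proof (cases "q\<^sub>2 = q\<^sub>1 \<or> q\<^sub>2 = - q\<^sub>1")
        case True
        have "measure lebesgue (?B q\<^sub>1 \<inter> ?B q\<^sub>2) \<le> ?\<mu> q\<^sub>1"
          unfolding B'_at_def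
          by (intro measure_mono_fmeasurable B'_lmeasurable fmeasurableD sets.Int) auto
        moreover have "0 \<le> 48 ^ ?m * (?\<Psi> q\<^sub>1 * ?\<Psi> q\<^sub>2)"
          using pos[OF supnorm[OF q(1)]] pos[OF supnorm[OF q(2)]] by simp
        moreover have "?\<mu> q\<^sub>1 \<le> (if q\<^sub>2 = q\<^sub>1 then ?\<mu> q\<^sub>1 else 0) + (if q\<^sub>2 = - q\<^sub>1 then ?\<mu> q\<^sub>1 else 0)"
          using True by auto
        ultimately show ?thesis by linarith
      next
        case False
        have "measure lebesgue (?B q\<^sub>1 \<inter> ?B q\<^sub>2) \<le> 48 ^ ?m * (?\<Psi> q\<^sub>1 * ?\<Psi> q\<^sub>2)"
          unfolding B'_at_def
          by (rule measure_B'_Int_le)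
            (use False q pos[OF supnorm] lt[OF supnorm] in \<open>auto simp: nonzero_ball_def\<close>)
        then show ?thesis using False by simp
      qed
      have WW: "48 ^ ?m * (W N)\<^sup>2 = (\<Sum>q\<^sub>1\<in>?Q N. \<Sum>q\<^sub>2\<in>?Q N. 48 ^ ?m * (?\<Psi> q\<^sub>1 * ?\<Psi> q\<^sub>2))"
        unfolding W_def power2_eq_square sum_product by (simp only: sum_distrib_left)
      have "(\<Sum>q\<^sub>1\<in>?Q N. \<Sum>q\<^sub>2\<in>?Q N. measure lebesgue (?B q\<^sub>1 \<inter> ?B q\<^sub>2))
        \<le> (\<Sum>q\<^sub>1\<in>?Q N. \<Sum>q\<^sub>2\<in>?Q N. 48 ^ ?m * (?\<Psi> q\<^sub>1 * ?\<Psi> q\<^sub>2)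
            + ((if q\<^sub>2 = q\<^sub>1 then ?\<mu> q\<^sub>1 else 0) + (if q\<^sub>2 = - q\<^sub>1 then ?\<mu> q\<^sub>1 else 0)))"
        by (intro sum_mono pair)
      also have "\<dots> = 48 ^ ?m * (W N)\<^sup>2 + (\<Sum>q\<^sub>1\<in>?Q N. (\<Sum>q\<^sub>2\<in>?Q N. if q\<^sub>2 = q\<^sub>1 then ?\<mu> q\<^sub>1 else 0)
            + (\<Sum>q\<^sub>2\<in>?Q N. if q\<^sub>2 = - q\<^sub>1 then ?\<mu> q\<^sub>1 else 0))"
        by (simp only: WW sum.distrib)
      also have "\<dots> \<le> 48 ^ ?m * (W N)\<^sup>2 + (\<Sum>q\<^sub>1\<in>?Q N. ?\<mu> q\<^sub>1 + ?\<mu> q\<^sub>1)"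
        by (intro add_left_mono sum_mono add_mono) (simp_all add: finite_nonzero_ball)
      also have "\<dots> = 48 ^ ?m * (W N)\<^sup>2 + 2 * S N"
        by (simp only: S_def sum.distrib mult_2)
      also have "\<dots> \<le> 48 ^ ?m * (4 * K * S N)\<^sup>2 + 2 * (S N)\<^sup>2"
        using elim W_le W_nonneg by (intro add_mono mult_left_mono power_mono self_le_power) auto
      also have "\<dots> = (48 ^ ?m * (4 * K)\<^sup>2 + 2) * (S N)\<^sup>2"
        by (simp add: power_mult_distrib algebra_simps)
      finally show ?case by (simp only: S_def)
    qed
  qed
qed

end
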